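(* Let $E$ be a Banach space and $C\subseteq E$ an open cone whose closure $\overline C$ is a normal cone, and equip $C$ with the Thompson metric $d_T$. Then the stochastic partial order, restricted to $\mathcal{P}^1(C)$, is a closed subset of $\mathcal{P}^1(C)\times\mathcal{P}^1(C)$ endowed with the product Wasserstein topology (induced by $d_1^W$).
   Context: $E$ is a real Banach space and $C\subseteq E$ is a nonempty open (convex) cone whose closure $\overline C$ is a proper cone, i.e. $\overline C\cap(-\overline C)=\{0\}$. The closed partial order on $E$ is $x\le y$ iff $y-x\in\overline C$, and $C$ carries its restriction. $\overline C$ is normal if there is a constant $K$ such that $0\le x\le y$ implies $\|x\|\le K\|y\|$. The Thompson metric on $C$ is $d_T(x,y)=\max\{\log M(x/y),\log M(y/x)\}$ with $M(x/y)=\inf\{\lambda>0:x\le\lambda y\}$; it is complete and induces on $C$ the topology inherited from $E$. $\mathcal{P}(C)$ denotes the set of $\tau$-additive Borel probability measures on $C$ ($\mu(U)=\sup_\alpha\mu(U_\alpha)$ for every directed union $U=\bigcup_\alpha U_\alpha$ of open sets); since $(C,d_T)$ is complete, this is equivalent to inner regularity by compact sets and to the support having measure $1$. $\mathcal{P}^1(C)$ is the set of $\mu\in\mathcal{P}(C)$ with $\int_C d_T(x,y)\,d\mu(y)<\infty$ for some (equivalently every) $x\in C$, with the metric $d_1^W(\mu,\nu)=\inf_{\pi\in\Pi(\mu,\nu)}\int_{C\times C}d_T(x,y)\,d\pi(x,y)$, where $\Pi(\mu,\nu)$ is the set of $\pi\in\mathcal{P}(C\times C)$ with marginals $\mu$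 and $\nu$. A subset $A\subseteq C$ is an upper set if $x\in A$, $y\in C$ and $x\le y$ imply $y\in A$. The stochastic order on $\mathcal{P}(C)$: $\mu\le\nu$ if $\mu(U)\le\nu(U)$ for each open upper set $U\subseteq C$. *)

theory Defs
  imports "HOL-Probability.Probability"
begin

(* The library predicates cone, conic and convex_cone force a nonempty cone to contain 0,
   which is impossible for an open cone with proper closure in a nonzero space. Hence only
   strictly positive scalars are used here. *)
definition open_proper_cone :: "'a::real_normed_vector set \<Rightarrow> bool" where
  "open_proper_cone C \<longleftrightarrow>
     C \<noteq> {} \<and> open C \<and> convex C \<and> (\<forall>x\<in>C. \<forall>t>0. t *\<^sub>R x \<in> C) \<and>
     closure C \<inter> uminus ` closure C = {0}"

definition cone_le :: "'a::real_normed_vector set \<Rightarrow> 'a \<Rightarrow> 'a \<Rightarrow> bool" where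
  "cone_le P x y \<longleftrightarrow> y - x \<in> P"

definition normal_cone :: "'a::real_normed_vector set \<Rightarrow> bool" where
  "normal_cone P \<longleftrightarrow>
     (\<exists>K::real. \<forall>x y. cone_le P 0 x \<and> cone_le P x y \<longrightarrow> norm x \<le> K * norm y)"

(* M(x/y); for x and y in an open cone C the set below is nonempty and bounded below. *)
definition thompson_M :: "'a::real_normed_vector set \<Rightarrow> 'a \<Rightarrow> 'a \<Rightarrow> real" where
  "thompson_M C x y = Inf {t. 0 < t \<and> cone_le (closure C) x (t *\<^sub>R y)}"

definition thompson_dist :: "'a::real_normed_vector set \<Rightarrow> 'a \<Rightarrow> 'a \<Rightarrow> real" where
  "thompson_dist C x y = max (ln (thompson_M C x y)) (ln (thompson_M C y x))"

definition tau_additive :: "'a::topological_space measure \<Rightarrow> bool" where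
  "tau_additive \<mu> \<longleftrightarrow>
     (\<forall>\<U>. \<U> \<noteq> {} \<and> (\<forall>U\<in>\<U>. openin (top_of_set (space \<mu>)) U) \<and>
          (\<forall>U\<in>\<U>. \<forall>V\<in>\<U>. \<exists>W\<in>\<U>. U \<union> V \<subseteq> W) \<longrightarrow>
          emeasure \<mu> (\<Union>\<U>) = (SUP U\<in>\<U>. emeasure \<mu> U))"

(* The Borel sigma-algebra of the subspace S is restrict_space borel S. For S = C the subspace
   topology is that of the Thompson metric (the closure of C being a normal cone). *)
definition tau_prob :: "'a::topological_space set \<Rightarrow> 'a measure set" where
  "tau_prob S =
     {\<mu>. sets \<mu> = sets (restrict_space borel S) \<and> prob_space \<mu> \<and> tau_additive \<mu>}"

definition tau_prob1 :: "'a::real_normed_vector set \<Rightarrow> 'a measure set" where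
  "tau_prob1 C =
     {\<mu> \<in> tau_prob C. \<exists>x\<in>C. (\<integral>\<^sup>+ y. ennreal (thompson_dist C x y) \<partial>\<mu>) < \<infinity>}"

(* Couplings live on the Borel sigma-algebra of the product topology, which for nonseparable
   spaces may be strictly larger than the product sigma-algebra. *)
definition couplings ::
  "'a::topological_space set \<Rightarrow> 'a measure \<Rightarrow> 'a measure \<Rightarrow> ('a \<times> 'a) measure set" where
  "couplings C \<mu> \<nu> =
     {\<pi> \<in> tau_prob (C \<times> C). distr \<pi> (restrict_space borel C) fst = \<mu> \<and>
                           distr \<pi> (restrict_space borel C) snd = \<nu>}"

(* The infimum is taken in the extended nonnegative reals; it is finite on tau_prob1 C, so
   the conversion to a real number loses nothing there. *)
definition wasserstein_dist ::
  "'a::real_normed_vector set \<Rightarrow> 'a measure \<Rightarrow> 'a measure \<Rightarrow> real" where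
  "wasserstein_dist C \<mu> \<nu> =
     enn2real (INF \<pi>\<in>couplings C \<mu> \<nu>.
       \<integral>\<^sup>+ p. ennreal (thompson_dist C (fst p) (snd p)) \<partial>\<pi>)"

definition wasserstein_topology :: "'a::real_normed_vector set \<Rightarrow> 'a measure topology" where
  "wasserstein_topology C = Metric_space.mtopology (tau_prob1 C) (wasserstein_dist C)"

definition upper_set_in :: "'a::real_normed_vector set \<Rightarrow> 'a set \<Rightarrow> bool" where
  "upper_set_in C A \<longleftrightarrow>
     A \<subseteq> C \<and> (\<forall>x\<in>A. \<forall>y\<in>C. cone_le (closure C) x y \<longrightarrow> y \<in> A)"

definition stochastic_le ::
  "'a::real_normed_vector set \<Rightarrow> 'a measure \<Rightarrow> 'a measure \<Rightarrow> bool" where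
  "stochastic_le C \<mu> \<nu> \<longleftrightarrow>
     (\<forall>U. openin (top_of_set C) U \<and> upper_set_in C U \<longrightarrow> emeasure \<mu> U \<le> emeasure \<nu> U)"

end

(* A set U that is open and upper is exhausted by the open upper sets
   U_s = {x. exp (-s) x is in U}, s > 0, and every point at Thompson distance less than r from
   U_s lies in U_(s-r). Markov's inequality for a coupling gives
   mu U_s <= mu' U_(s-r) + W(mu, mu') / r, so a strict violation mu U > nu U of the stochastic
   order persists under small Wasserstein perturbations of mu and nu.

   The library's metric topology is only determined for an actual metric, so the metric axioms of
   the Wasserstein distance are needed as well. The triangle inequality is obtained without
   disintegration, by gluing two couplings along a countable partition into pieces of small
   diameter. Since E need not be separable, couplings are first built on the product
   sigma-algebra and extended to the Borel sets of C x C using that a tau-additive probability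
   measure is carried by a separable set. *)
theory Submission
  imports Defs
begin

section \<open>Tau-additive measures and couplings\<close>

text \<open>A Thompson distance below r from x to y says in particular that x is at most exp r times
  y. Dilating an upper set absorbs exactly this inequality, so the enlargement of U_s needed for
  Markov's inequality is again one of the open upper sets. Both measures are perturbed, so two
  enlargements are made: U_(2r) to U_r for mu and U_r to U for nu. The middle set U_r witnesses the
  violation for the perturbed pair. Normality of the closed cone enters through definiteness of the
  Wasserstein distance: it puts small Thompson balls inside norm neighbourhoods, so that measures at
  distance 0 agree on open sets. The opposite comparison, that Thompson balls are norm
  neighbourhoods of their centres, comes from openness of the cone and makes the pieces of small
  diameter cover a separable carrier. With countably many pieces, conditioning on a piece is
  division by its probability, so gluing needs an explicit density and no kernels.\<close>

lemma tau_probD: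
  assumes "\<mu> \<in> tau_prob X"
  shows "sets \<mu> = sets (restrict_space borel X)" "prob_space \<mu>" "tau_additive \<mu>" "space \<mu> = X"
  using assms sets_eq_imp_space_eq[of \<mu> "restrict_space borel X"]
  by (auto simp: tau_prob_def space_restrict_space)

lemma openin_in_sets_restrict_borel:
  assumes "openin (top_of_set X) U"
  shows "U \<in> sets (restrict_space borel X)"
proof -
  obtain T where "open T" "U = X \<inter> T" using assms by (meson openin_open)
  then show ?thesis unfolding sets_restrict_space by (intro image_eqI[of _ _ T]) auto
qed

lemma tau_prob_sets_openin:
  assumes "\<mu> \<in> tau_prob X" "openin (top_of_set X) U"
  shows "U \<in> sets \<mu>"
  using assms by (simp add: tau_probD(1) openin_in_sets_restrict_borel)

section \<open>Separable carriers and tau-additivity\<close>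

text \<open>Balls of radius 1/(n+1) about points of \<open>D\<close> suffice: if this radius is
  below e/2 and the centre is that close to \<open>x\<close>, the ball contains \<open>x\<close> and
  stays within e of it. The members are open in the ambient space, which avoids a separate topology
  on the carrier.\<close>

lemma countable_base_at_closure:
  fixes D :: "'a::metric_space set"
  assumes "countable D"
  obtains B where "countable B" "\<And>b. b \<in> B \<Longrightarrow> open b"
    "\<And>x G. x \<in> closure D \<Longrightarrow> open G \<Longrightarrow> x \<in> G \<Longrightarrow> \<exists>b\<in>B. x \<in> b \<and> b \<subseteq> G"
proof
  let ?B = "(\<lambda>(d, n). ball d (1 / real (Suc n))) ` (D \<times> (UNIV :: nat set))"
  show "countable ?B" using assms by auto
  show "open b" if "b \<in> ?B" for b using that by auto
  fix x G assume x: "x \<in> closure D" and G: "open G" "x \<in> G"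
  obtain e where e: "e > 0" "ball x e \<subseteq> G" using G by (meson openE)
  obtain n where n: "1 / real (Suc n) < e / 2"
    using nat_approx_posE[of "e/2"] e(1) by auto
  obtain d where d: "d \<in> D" "dist d x < 1 / real (Suc n)"
    using x by (meson closure_approachable of_nat_0_less_iff zero_less_Suc zero_less_divide_1_iff)
  have "ball d (1 / real (Suc n)) \<subseteq> ball x e"
  proof
    fix y assume "y \<in> ball d (1 / real (Suc n))"
    then have "dist d y < e / 2" using n by auto
    moreover have "dist d x < e / 2" using d n by auto
    ultimately show "y \<in> ball x e" using dist_triangle3[of x y d] by (auto)
  qed
  then show "\<exists>b\<in>?B. x \<in> b \<and> b \<subseteq> G"
    using d e(2) by (intro bexI[of _ "ball d (1 / real (Suc n))"]) auto
qed

lemma (in prob_space) AE_in_countable_INT: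
  assumes "\<And>n::nat. A n \<in> events" "\<And>n. emeasure M (A n) = 1"
  shows "AE x in M. x \<in> (\<Inter>n. A n)"
proof -
  have "AE x in M. x \<in> A n" for n
    using assms[of n] by (intro AE_prob_1) (simp add: measure_def)
  then show ?thesis by (simp add: AE_all_countable)
qed

text \<open>For fixed r the finite unions of r-balls centred in \<open>X\<close> are directed and
  cover \<open>X\<close>, so tau-additivity makes their measures tend to 1. Countably many centres
  therefore catch full measure, and intersecting over r = 1/(n+1) leaves points that are limits of
  centres.\<close>

lemma tau_prob_separable_carrier:
  fixes \<mu> :: "'a::metric_space measure"
  assumes mu: "\<mu> \<in> tau_prob X"
  obtains D S where "countable D" "D \<subseteq> X" "S \<in> sets \<mu>" "S \<subseteq> closure D" "AE x in \<mu>. x \<in> S"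
proof -
  interpret prob_space \<mu> using mu by (rule tau_probD)
  define cov where "cov r F = X \<inter> (\<Union>x\<in>F. ball x r)" for r F
  have cov_open: "openin (top_of_set X) (cov r F)" for r F
    unfolding cov_def by (auto intro!: openin_open_Int)
  have cov_sets: "cov r F \<in> sets \<mu>" for r F
    using mu cov_open by (rule tau_prob_sets_openin)
  have ex: "\<exists>D. countable D \<and> D \<subseteq> X \<and> emeasure \<mu> (cov r D) = 1" if r: "r > 0" for r
  proof -
    let ?\<F> = "{F. finite F \<and> F \<subseteq> X}"
    have "emeasure \<mu> (\<Union> (cov r ` ?\<F>)) = (SUP U\<in>cov r ` ?\<F>. emeasure \<mu> U)"
    proof (rule tau_probD(3)[OF mu, unfolded tau_additive_def, rule_format], intro conjI ballI)
      show "cov r ` ?\<F> \<noteq> {}" by auto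
      show "openin (top_of_set (space \<mu>)) U" if "U \<in> cov r ` ?\<F>" for U
        using that cov_open by (auto simp: tau_probD(4)[OF mu])
      fix U V assume "U \<in> cov r ` ?\<F>" "V \<in> cov r ` ?\<F>"
      then obtain F G where "F \<in> ?\<F>" "G \<in> ?\<F>" "U = cov r F" "V = cov r G" by auto
      then show "\<exists>W\<in>cov r ` ?\<F>. U \<union> V \<subseteq> W"
        by (intro bexI[of _ "cov r (F \<union> G)"] imageI) (auto simp: cov_def)
    qed
    moreover have "\<Union> (cov r ` ?\<F>) = space \<mu>"
    proof
      show "space \<mu> \<subseteq> \<Union> (cov r ` ?\<F>)"
      proof
        fix x assume "x \<in> space \<mu>"
        then have "x \<in> cov r {x}" "{x} \<in> ?\<F>" using r by (auto simp: cov_def tau_probD(4)[OF mu])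
        then show "x \<in> \<Union> (cov r ` ?\<F>)" by blast
      qed
    qed (auto simp: cov_def tau_probD(4)[OF mu])
    ultimately have 1: "(SUP F\<in>?\<F>. emeasure \<mu> (cov r F)) = 1"
      by (simp add: emeasure_space_1 image_comp)
    have "?\<F> \<noteq> {}" by auto
    \<comment> \<open>A supremum of extended reals is already the supremum of a sequence; this
      reduces all finite sets of centres to countably many.\<close>
    from ennreal_SUP_countable_SUP[OF this, of "\<lambda>F. emeasure \<mu> (cov r F)"]
    obtain f :: "nat \<Rightarrow> ennreal" where f: "range f \<subseteq> (\<lambda>F. emeasure \<mu> (cov r F)) ` ?\<F>" "(SUP i. f i) = 1"
      using 1 by auto
    then have "\<forall>i. \<exists>F\<in>?\<F>. f i = emeasure \<mu> (cov r F)" by auto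
    then obtain F where F: "\<And>i. F i \<in> ?\<F>" "\<And>i. f i = emeasure \<mu> (cov r (F i))" by metis
    let ?D = "\<Union>i. F i"
    have "f i \<le> emeasure \<mu> (cov r ?D)" for i
      unfolding F(2) by (intro emeasure_mono cov_sets) (auto simp: cov_def)
    then have "1 \<le> emeasure \<mu> (cov r ?D)"
      unfolding f(2)[symmetric] by (intro SUP_least)
    moreover have "countable ?D" using F(1) by (auto intro: countable_finite)
    moreover have "?D \<subseteq> X" using F(1) by auto
    ultimately show ?thesis
      using emeasure_space_le_1 by (metis antisym emeasure_space emeasure_space_1)
  qed
  then have "\<forall>n. \<exists>D. countable D \<and> D \<subseteq> X \<and> emeasure \<mu> (cov (1 / real (Suc n)) D) = 1"
    by simp
  then obtain D where D: "\<And>n. countable (D n)" "\<And>n. D n \<subseteq> X" "\<And>n. emeasure \<mu> (cov (1 / real (Suc n)) (D n)) = 1"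
    by metis
  let ?S = "\<Inter>n. cov (1 / real (Suc n)) (D n)"
  show thesis
  proof
    show "countable (\<Union>n. D n)" "(\<Union>n. D n) \<subseteq> X" using D by auto
    show "?S \<in> sets \<mu>" using cov_sets by auto
    show "AE x in \<mu>. x \<in> ?S" using D(3) cov_sets by (intro AE_in_countable_INT)
    show "?S \<subseteq> closure (\<Union>n. D n)"
    proof
      fix x assume x: "x \<in> ?S"
      show "x \<in> closure (\<Union>n. D n)"
        unfolding closure_approachable
      proof (intro allI impI)
        fix e :: real assume "e > 0"
        then obtain n where n: "1 / real (Suc n) < e" by (rule nat_approx_posE)
        have "x \<in> cov (1 / real (Suc n)) (D n)" using x by blast
        then obtain y where "y \<in> D n" "dist y x < 1 / real (Suc n)" by (auto simp: cov_def)
        with n show "\<exists>y\<in>\<Union>n. D n. dist y x < e" by (intro bexI[of _ y]) auto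
      qed
    qed
  qed
qed

text \<open>A converse to the existence of separable carriers, by a Lindel"of argument: up to a null
  set, countably many members of a directed family already cover its union. Finite unions of these
  lie below single members, and continuity from below does the rest.\<close>

lemma tau_additive_countable_base:
  assumes sets: "sets \<mu> = sets (restrict_space borel X)"
    and S: "AE x in \<mu>. x \<in> S"
    and B: "countable B"
      "\<And>x G. x \<in> S \<Longrightarrow> open G \<Longrightarrow> x \<in> G \<Longrightarrow> \<exists>b\<in>B. x \<in> b \<and> b \<subseteq> G"
  shows "tau_additive \<mu>"
  unfolding tau_additive_def
proof (intro allI impI, elim conjE)
  fix \<U> assume ne: "\<U> \<noteq> {}" and op: "\<forall>U\<in>\<U>. openin (top_of_set (space \<mu>)) U"
    and dir: "\<forall>U\<in>\<U>. \<forall>V\<in>\<U>. \<exists>W\<in>\<U>. U \<union> V \<subseteq> W"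
  have sp: "space \<mu> = X"
    using sets_eq_imp_space_eq[OF sets] by (simp add: space_restrict_space)
  have oin: "U \<in> sets \<mu>" if "openin (top_of_set X) U" for U
    using that by (simp add: sets openin_in_sets_restrict_borel)
  have U_sets: "U \<in> sets \<mu>" if "U \<in> \<U>" for U
    using that op by (auto simp: sp intro: oin)
  have Un_sets: "\<Union>\<U> \<in> sets \<mu>"
    using op by (auto simp: sp intro: oin)
  define B' where "B' = {b\<in>B. \<exists>U\<in>\<U>. b \<inter> X \<subseteq> U}"
  have "\<forall>b\<in>B'. \<exists>U\<in>\<U>. b \<inter> X \<subseteq> U" by (auto simp: B'_def)
  then obtain u where u: "\<And>b. b \<in> B' \<Longrightarrow> u b \<in> \<U>" "\<And>b. b \<in> B' \<Longrightarrow> b \<inter> X \<subseteq> u b"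
    by metis
  obtain U0 where U0: "U0 \<in> \<U>" using ne by auto
  have cnt: "countable (insert U0 (u ` B'))" using B(1) by (auto simp: B'_def)
  \<comment> \<open>Inserting \<open>U0\<close> keeps the countable set nonempty, so that
    \<open>from_nat_into\<close> enumerates exactly this set.\<close>
  define V where "V = from_nat_into (insert U0 (u ` B'))"
  have V_range: "range V = insert U0 (u ` B')"
    unfolding V_def using cnt by (intro range_from_nat_into) auto
  have V_in: "V n \<in> \<U>" for n
  proof -
    have "V n \<in> insert U0 (u ` B')" unfolding V_range[symmetric] by (rule rangeI)
    then show ?thesis using U0 u(1) by auto
  qed
  have cover: "x \<in> (\<Union>n. V n)" if x: "x \<in> S" "x \<in> \<Union>\<U>" for x
  proof -
    obtain U where U: "U \<in> \<U>" "x \<in> U" using x by auto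
    then obtain T where T: "open T" "U = X \<inter> T" using op U(1) unfolding sp by (meson openin_open)
    then obtain b where b: "b \<in> B" "x \<in> b" "b \<subseteq> T" using B(2)[OF x(1) T(1)] U(2) by blast
    then have "b \<in> B'" using U T unfolding B'_def by blast
    then have "x \<in> u b" using u(2) b U T by auto
    moreover have "u b \<in> range V" unfolding V_range using \<open>b \<in> B'\<close> by simp
    ultimately show ?thesis by auto
  qed
  have fin: "\<exists>W\<in>\<U>. (\<Union>i<n. V i) \<subseteq> W" for n :: nat
  proof (induction n)
    case 0
    then show ?case using U0 by auto
  next
    case (Suc n)
    then obtain W where W: "W \<in> \<U>" "(\<Union>i<n. V i) \<subseteq> W" by auto
    obtain W' where "W' \<in> \<U>" "W \<union> V n \<subseteq> W'" using dir W(1) V_in by blast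
    moreover have "(\<Union>i<Suc n. V i) = (\<Union>i<n. V i) \<union> V n" by (simp add: lessThan_Suc Un_commute)
    ultimately show ?case using W by blast
  qed
  have "emeasure \<mu> (\<Union>\<U>) \<le> emeasure \<mu> (\<Union>n. V n)"
    using S U_sets V_in cover by (intro emeasure_mono_AE) (auto)
  also have "(\<Union>n. V n) = (\<Union>n. \<Union>i<n. V i)"
    by (simp add: UN_UN_finite_eq[of V, unfolded atLeast0LessThan])
  also have "emeasure \<mu> \<dots> = (SUP n. emeasure \<mu> (\<Union>i<n. V i))"
  proof (intro SUP_emeasure_incseq[symmetric] incseq_SucI)
    show "range (\<lambda>n. \<Union>i<n. V i) \<subseteq> sets \<mu>" using U_sets V_in by auto
    show "(\<Union>i<n. V i) \<subseteq> (\<Union>i<Suc n. V i)" for n by (rule UN_mono) auto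
  qed
  also have "\<dots> \<le> (SUP U\<in>\<U>. emeasure \<mu> U)"
  proof (rule SUP_least)
    fix n
    obtain W where W: "W \<in> \<U>" "(\<Union>i<n. V i) \<subseteq> W" using fin by blast
    then have "emeasure \<mu> (\<Union>i<n. V i) \<le> emeasure \<mu> W"
      using U_sets by (intro emeasure_mono) auto
    with W show "emeasure \<mu> (\<Union>i<n. V i) \<le> (SUP U\<in>\<U>. emeasure \<mu> U)"
      by (meson SUP_upper2)
  qed
  finally have "emeasure \<mu> (\<Union>\<U>) \<le> (SUP U\<in>\<U>. emeasure \<mu> U)" .
  moreover have "(SUP U\<in>\<U>. emeasure \<mu> U) \<le> emeasure \<mu> (\<Union>\<U>)"
    using Un_sets by (intro SUP_least emeasure_mono) auto
  ultimately show "emeasure \<mu> (\<Union>\<U>) = (SUP U\<in>\<U>. emeasure \<mu> U)"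
    by (rule antisym)
qed

section \<open>Couplings from random variables, gluing and continuous images\<close>

lemma measurable_restrict_borel_fst:
  "fst \<in> restrict_space borel (X \<times> Y) \<rightarrow>\<^sub>M (restrict_space borel X :: 'a::topological_space measure)"
  and measurable_restrict_borel_snd:
  "snd \<in> restrict_space borel (X \<times> Y) \<rightarrow>\<^sub>M (restrict_space borel Y :: 'b::topological_space measure)"
  by (auto intro!: measurable_restrict_space3 borel_measurable_continuous_onI continuous_on_fst
      continuous_on_snd continuous_on_id)

text \<open>The pair of \<open>X\<close> and \<open>Y\<close> is a priori measurable only for the
  product sigma-algebra. On the product of two separable carriers every open set is a countable
  union of open rectangles, so a modification of the pair on a null set is Borel; almost sure
  equality preserves the marginals.\<close>

lemma coupling_of_random_variables:
  fixes C :: "'a::metric_space set"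
  assumes "prob_space \<Omega>"
    and X: "X \<in> \<Omega> \<rightarrow>\<^sub>M restrict_space borel C" and Y: "Y \<in> \<Omega> \<rightarrow>\<^sub>M restrict_space borel C"
    and laws: "distr \<Omega> (restrict_space borel C) X \<in> tau_prob C"
      "distr \<Omega> (restrict_space borel C) Y \<in> tau_prob C"
  obtains f where "f \<in> \<Omega> \<rightarrow>\<^sub>M restrict_space borel (C \<times> C)"
    "AE \<omega> in \<Omega>. f \<omega> = (X \<omega>, Y \<omega>)"
    "distr \<Omega> (restrict_space borel (C \<times> C)) f \<in>
      couplings C (distr \<Omega> (restrict_space borel C) X) (distr \<Omega> (restrict_space borel C) Y)"
proof -
  interpret prob_space \<Omega> by fact
  let ?R = "restrict_space borel C" and ?R2 = "restrict_space borel (C \<times> C)"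
  obtain D S where S: "countable D" "S \<in> sets ?R" "S \<subseteq> closure D" "AE x in distr \<Omega> ?R X. x \<in> S"
    using tau_prob_separable_carrier[OF laws(1)] by (metis sets_distr)
  obtain E T where T: "countable E" "T \<in> sets ?R" "T \<subseteq> closure E" "AE x in distr \<Omega> ?R Y. x \<in> T"
    using tau_prob_separable_carrier[OF laws(2)] by (metis sets_distr)
  obtain A where A: "countable A" "\<And>b. b \<in> A \<Longrightarrow> open b"
    "\<And>x G. x \<in> closure D \<Longrightarrow> open G \<Longrightarrow> x \<in> G \<Longrightarrow> \<exists>b\<in>A. x \<in> b \<and> b \<subseteq> G"
    using S(1) by (rule countable_base_at_closure) blast
  obtain B where B: "countable B" "\<And>b. b \<in> B \<Longrightarrow> open b"
    "\<And>x G. x \<in> closure E \<Longrightarrow> open G \<Longrightarrow> x \<in> G \<Longrightarrow> \<exists>b\<in>B. x \<in> b \<and> b \<subseteq> G"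
    using T(1) by (rule countable_base_at_closure) blast
  have base: "\<exists>a\<in>A. \<exists>b\<in>B. p \<in> a \<times> b \<and> a \<times> b \<subseteq> G"
    if p: "p \<in> S \<times> T" and G: "open G" "p \<in> G" for p G
  proof -
    obtain U V where UV: "open U" "open V" "fst p \<in> U" "snd p \<in> V" "U \<times> V \<subseteq> G"
      using G by (metis open_prod_elim mem_Times_iff)
    obtain a where "a \<in> A" "fst p \<in> a" "a \<subseteq> U" using A(3)[of "fst p" U] UV p S(3) by (auto simp: mem_Times_iff subset_iff)
    moreover obtain b where "b \<in> B" "snd p \<in> b" "b \<subseteq> V" using B(3)[of "snd p" V] UV p T(3) by (auto simp: mem_Times_iff subset_iff)
    ultimately show ?thesis using UV(5) by (intro bexI[of _ a] bexI[of _ b]) (auto simp: mem_Times_iff)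
  qed
  obtain \<omega>0 where w0: "\<omega>0 \<in> space \<Omega>" using not_empty by auto
  have XC: "X \<omega> \<in> C" if "\<omega> \<in> space \<Omega>" for \<omega>
    using measurable_space[OF X that] by (simp add: space_restrict_space)
  have YC: "Y \<omega> \<in> C" if "\<omega> \<in> space \<Omega>" for \<omega>
    using measurable_space[OF Y that] by (simp add: space_restrict_space)
  \<comment> \<open>The default is a fixed value of the pair, hence a point of
    \<open>C \<times> C\<close>. Being constant, it adds to a preimage either the whole exceptional
    set or nothing.\<close>
  define f where "f \<omega> = (if X \<omega> \<in> S \<and> Y \<omega> \<in> T then (X \<omega>, Y \<omega>) else (X \<omega>0, Y \<omega>0))" for \<omega>
  have XS: "X -` S \<inter> space \<Omega> \<in> sets \<Omega>" using X S(2) by (rule measurable_sets)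
  have YT: "Y -` T \<inter> space \<Omega> \<in> sets \<Omega>" using Y T(2) by (rule measurable_sets)
  have f_borel: "f \<in> borel_measurable \<Omega>"
  proof (rule borel_measurableI)
    fix G :: "('a \<times> 'a) set" assume G: "open G"
    let ?I = "{(a, b) \<in> A \<times> B. a \<times> b \<subseteq> G}"
    let ?W = "(\<Union>(a, b)\<in>?I. ((X -` S \<inter> space \<Omega>) \<inter> (Y -` T \<inter> space \<Omega>)) \<inter> (X -` (C \<inter> a) \<inter> space \<Omega>) \<inter> (Y -` (C \<inter> b) \<inter> space \<Omega>))"
    let ?N = "space \<Omega> - (X -` S \<inter> space \<Omega>) \<inter> (Y -` T \<inter> space \<Omega>)"
    have "countable ?I" using A(1) B(1) by (rule countable_subset[rotated, OF countable_SIGMA]) auto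
    have W: "?W \<in> sets \<Omega>"
    proof (rule sets.countable_UN''[OF \<open>countable ?I\<close>])
      fix p assume "p \<in> ?I"
      then obtain a b where p: "p = (a, b)" "a \<in> A" "b \<in> B" by auto
      then have "C \<inter> a \<in> sets ?R" "C \<inter> b \<in> sets ?R"
        using A(2) B(2) by (auto simp: sets_restrict_space)
      then show "(case p of (a, b) \<Rightarrow> ((X -` S \<inter> space \<Omega>) \<inter> (Y -` T \<inter> space \<Omega>)) \<inter> (X -` (C \<inter> a) \<inter> space \<Omega>) \<inter> (Y -` (C \<inter> b) \<inter> space \<Omega>)) \<in> sets \<Omega>"
        unfolding p(1) prod.case
        using XS YT by (metis sets.Int measurable_sets[OF X] measurable_sets[OF Y])
    qed
    have "f -` G \<inter> space \<Omega> = ?W \<union> (if (X \<omega>0, Y \<omega>0) \<in> G then ?N else {})"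
    proof (intro set_eqI iffI)
      fix \<omega> assume w: "\<omega> \<in> f -` G \<inter> space \<Omega>"
      show "\<omega> \<in> ?W \<union> (if (X \<omega>0, Y \<omega>0) \<in> G then ?N else {})"
      proof (cases "X \<omega> \<in> S \<and> Y \<omega> \<in> T")
        case True
        then have "(X \<omega>, Y \<omega>) \<in> G" "(X \<omega>, Y \<omega>) \<in> S \<times> T" using w by (auto simp: f_def)
        then obtain a b where "a \<in> A" "b \<in> B" "(X \<omega>, Y \<omega>) \<in> a \<times> b" "a \<times> b \<subseteq> G"
          using base[of "(X \<omega>, Y \<omega>)" G] G by blast
        then show ?thesis using True w XC YC by (intro UnI1 UN_I[of "(a, b)"]) auto
      next
        case False
        then show ?thesis using w by (auto simp: f_def)
      qed
    next
      fix \<omega> assume "\<omega> \<in> ?W \<union> (if (X \<omega>0, Y \<omega>0) \<in> G then ?N else {})"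
      then show "\<omega> \<in> f -` G \<inter> space \<Omega>"
        by (auto simp: f_def split: if_splits)
    qed
    also have "\<dots> \<in> sets \<Omega>" using W XS YT by auto
    finally show "f -` G \<inter> space \<Omega> \<in> sets \<Omega>" .
  qed
  have f: "f \<in> \<Omega> \<rightarrow>\<^sub>M ?R2"
    using f_borel XC YC w0 by (intro measurable_restrict_space2) (auto simp: f_def)
  have AE_ST: "AE \<omega> in \<Omega>. X \<omega> \<in> S \<and> Y \<omega> \<in> T"
    using AE_distrD[OF X S(4)] AE_distrD[OF Y T(4)] by (auto)
  have AE_f: "AE \<omega> in \<Omega>. f \<omega> = (X \<omega>, Y \<omega>)"
    using AE_ST by eventually_elim (simp add: f_def)
  let ?\<pi> = "distr \<Omega> ?R2 f"
  have "tau_additive ?\<pi>"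
  proof (rule tau_additive_countable_base)
    show "sets ?\<pi> = sets (restrict_space borel (C \<times> C))" by simp
    have SC: "S \<times> T \<inter> space ?R2 \<in> sets ?R2"
    proof -
      have "fst -` S \<inter> space ?R2 \<inter> (snd -` T \<inter> space ?R2) \<in> sets ?R2"
        by (intro sets.Int measurable_sets[OF measurable_restrict_borel_fst S(2)]
            measurable_sets[OF measurable_restrict_borel_snd T(2)])
      also have "fst -` S \<inter> space ?R2 \<inter> (snd -` T \<inter> space ?R2) = S \<times> T \<inter> space ?R2" by auto
      finally show ?thesis .
    qed
    have "AE \<omega> in \<Omega>. f \<omega> \<in> S \<times> T"
      using AE_ST by eventually_elim (simp add: f_def)
    then show "AE p in ?\<pi>. p \<in> S \<times> T"
      using SC by (subst AE_distr_iff[OF f]) (simp_all add: Int_def conj_commute)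
    show "countable ((\<lambda>(a, b). a \<times> b) ` (A \<times> B))" using A(1) B(1) by auto
    fix p G assume "p \<in> S \<times> T" "open G" "p \<in> G"
    then show "\<exists>b\<in>(\<lambda>(a, b). a \<times> b) ` (A \<times> B). p \<in> b \<and> b \<subseteq> G"
      using base[of p G] by (simp add: Bex_def)
  qed
  then have "?\<pi> \<in> tau_prob (C \<times> C)"
    using prob_space_distr[OF f] by (simp add: tau_prob_def)
  moreover have "distr ?\<pi> ?R fst = distr \<Omega> ?R X"
    unfolding distr_distr[OF measurable_restrict_borel_fst f]
  proof (rule distr_cong_AE[OF refl refl _ measurable_comp[OF f measurable_restrict_borel_fst] X])
    show "AE \<omega> in \<Omega>. (fst \<circ> f) \<omega> = X \<omega>" using AE_f by eventually_elim simp
  qed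
  moreover have "distr ?\<pi> ?R snd = distr \<Omega> ?R Y"
    unfolding distr_distr[OF measurable_restrict_borel_snd f]
  proof (rule distr_cong_AE[OF refl refl _ measurable_comp[OF f measurable_restrict_borel_snd] Y])
    show "AE \<omega> in \<Omega>. (snd \<circ> f) \<omega> = Y \<omega>" using AE_f by eventually_elim simp
  qed
  ultimately have "?\<pi> \<in> couplings C (distr \<Omega> ?R X) (distr \<Omega> ?R Y)"
    by (simp add: couplings_def)
  then show thesis using that f AE_f by blast
qed

text \<open>The measure makes the two coordinates conditionally independent given their common
  label. Its density against the product is 1 / P(label) where the labels agree and 0 elsewhere;
  integrating out either coordinate gives 1 almost surely, which yields both marginals.\<close>

lemma glue_along_countable:
  fixes a :: "'p \<Rightarrow> 'i::countable" and b :: "'q \<Rightarrow> 'i"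
  assumes P: "prob_space P" and Q: "prob_space Q"
    and a: "a \<in> P \<rightarrow>\<^sub>M count_space UNIV" and b: "b \<in> Q \<rightarrow>\<^sub>M count_space UNIV"
    and eq: "distr P (count_space UNIV) a = distr Q (count_space UNIV) b"
  obtains \<Omega> where "prob_space \<Omega>" "sets \<Omega> = sets (P \<Otimes>\<^sub>M Q)"
    "distr \<Omega> P fst = P" "distr \<Omega> Q snd = Q" "AE z in \<Omega>. a (fst z) = b (snd z)"
proof -
  interpret P: prob_space P by fact
  interpret Q: prob_space Q by fact
  interpret PQ: pair_prob_space P Q ..
  define w where "w i = emeasure P (a -` {i} \<inter> space P)" for i
  have wQ: "w i = emeasure Q (b -` {i} \<inter> space Q)" for i
    using arg_cong[OF eq, of "\<lambda>m. emeasure m {i}"] a b by (simp add: w_def emeasure_distr)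
  define g where "g = (\<lambda>(p, q). if a p = b q then inverse (w (b q)) else 0)"
  note [measurable] = a b
  have [measurable]: "g \<in> borel_measurable (P \<Otimes>\<^sub>M Q)"
    unfolding g_def by measurable
  have inv: "inverse (w i) * w i = 1" if "w i \<noteq> 0" for i
  proof -
    have "w i < top" by (simp add: w_def P.emeasure_finite less_top[symmetric])
    then show ?thesis using ennreal_divide_self[OF that] by (simp add: divide_ennreal_def mult.commute)
  qed
  \<comment> \<open>In \<open>ennreal\<close> the inverse of 0 is infinite, so labels of weight 0
    would spoil the normalisation. As there are only countably many labels, almost surely none of
    weight 0 occurs.\<close>
  have "AE p in P. \<forall>i. w i = 0 \<longrightarrow> a p \<noteq> i"
    unfolding AE_all_countable
  proof
    fix i
    show "AE p in P. w i = 0 \<longrightarrow> a p \<noteq> i"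
    proof (cases "w i = 0")
      case True
      then have "AE p in P. p \<notin> a -` {i} \<inter> space P"
        using a by (intro AE_not_in) (simp add: w_def null_sets_def)
      then show ?thesis using AE_space by eventually_elim auto
    qed simp
  qed
  then have gP: "AE p in P. (\<integral>\<^sup>+ q. g (p, q) \<partial>Q) = 1"
  proof eventually_elim
    case (elim p)
    have "(\<integral>\<^sup>+ q. g (p, q) \<partial>Q) = (\<integral>\<^sup>+ q. inverse (w (a p)) * indicator (b -` {a p} \<inter> space Q) q \<partial>Q)"
      by (intro nn_integral_cong) (auto simp: g_def indicator_def)
    also have "\<dots> = inverse (w (a p)) * w (a p)"
      by (subst nn_integral_cmult_indicator) (auto simp: wQ)
    also have "\<dots> = 1" using elim inv by blast
    finally show ?case .
  qed
  have "AE q in Q. \<forall>i. w i = 0 \<longrightarrow> b q \<noteq> i"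
    unfolding AE_all_countable
  proof
    fix i
    show "AE q in Q. w i = 0 \<longrightarrow> b q \<noteq> i"
    proof (cases "w i = 0")
      case True
      then have "AE q in Q. q \<notin> b -` {i} \<inter> space Q"
        using b by (intro AE_not_in) (simp add: wQ null_sets_def)
      then show ?thesis using AE_space by eventually_elim auto
    qed simp
  qed
  then have gQ: "AE q in Q. (\<integral>\<^sup>+ p. g (p, q) \<partial>P) = 1"
  proof eventually_elim
    case (elim q)
    have "(\<integral>\<^sup>+ p. g (p, q) \<partial>P) = (\<integral>\<^sup>+ p. inverse (w (b q)) * indicator (a -` {b q} \<inter> space P) p \<partial>P)"
      by (intro nn_integral_cong) (auto simp: g_def indicator_def)
    also have "\<dots> = inverse (w (b q)) * w (b q)"
      by (subst nn_integral_cmult_indicator) (auto simp: w_def)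
    also have "\<dots> = 1" using elim inv by blast
    finally show ?case .
  qed
  let ?\<Omega> = "density (P \<Otimes>\<^sub>M Q) g"
  have distr_fst: "distr ?\<Omega> P fst = P"
  proof (rule measure_eqI)
    fix A assume "A \<in> sets (distr ?\<Omega> P fst)"
    then have A[measurable]: "A \<in> sets P" by simp
    have "emeasure (distr ?\<Omega> P fst) A = (\<integral>\<^sup>+ z. g z * indicator (fst -` A \<inter> space ?\<Omega>) z \<partial>(P \<Otimes>\<^sub>M Q))"
      using measurable_sets[OF measurable_fst A, of Q]
      by (simp add: emeasure_distr emeasure_density)
    also have "\<dots> = (\<integral>\<^sup>+ z. g z * indicator A (fst z) \<partial>(P \<Otimes>\<^sub>M Q))"
      by (intro nn_integral_cong) (auto simp: indicator_def)
    also have "\<dots> = (\<integral>\<^sup>+ p. \<integral>\<^sup>+ q. g (p, q) * indicator A (fst (p, q)) \<partial>Q \<partial>P)"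
      by (rule Q.nn_integral_fst[symmetric]) measurable
    also have "\<dots> = (\<integral>\<^sup>+ p. (\<integral>\<^sup>+ q. g (p, q) \<partial>Q) * indicator A p \<partial>P)"
      by (intro nn_integral_cong) (simp add: nn_integral_multc)
    also have "\<dots> = (\<integral>\<^sup>+ p. indicator A p \<partial>P)"
      using gP by (intro nn_integral_cong_AE) auto
    finally show "emeasure (distr ?\<Omega> P fst) A = emeasure P A" by simp
  qed simp
  have distr_snd: "distr ?\<Omega> Q snd = Q"
  proof (rule measure_eqI)
    fix A assume "A \<in> sets (distr ?\<Omega> Q snd)"
    then have A[measurable]: "A \<in> sets Q" by simp
    have "emeasure (distr ?\<Omega> Q snd) A = (\<integral>\<^sup>+ z. g z * indicator (snd -` A \<inter> space ?\<Omega>) z \<partial>(P \<Otimes>\<^sub>M Q))"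
      using measurable_sets[OF measurable_snd A, of P]
      by (simp add: emeasure_distr emeasure_density)
    also have "\<dots> = (\<integral>\<^sup>+ z. g z * indicator A (snd z) \<partial>(P \<Otimes>\<^sub>M Q))"
      by (intro nn_integral_cong) (auto simp: indicator_def)
    also have "\<dots> = (\<integral>\<^sup>+ q. \<integral>\<^sup>+ p. g (p, q) * indicator A (snd (p, q)) \<partial>P \<partial>Q)"
      by (rule PQ.nn_integral_snd[symmetric]) (simp add: split_beta')
    also have "\<dots> = (\<integral>\<^sup>+ q. (\<integral>\<^sup>+ p. g (p, q) \<partial>P) * indicator A q \<partial>Q)"
      by (intro nn_integral_cong) (simp add: nn_integral_multc)
    also have "\<dots> = (\<integral>\<^sup>+ q. indicator A q \<partial>Q)"
      using gQ by (intro nn_integral_cong_AE) auto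
    finally show "emeasure (distr ?\<Omega> Q snd) A = emeasure Q A" by simp
  qed simp
  show thesis
  proof
    have "emeasure (distr ?\<Omega> P fst) (space P) = 1"
      unfolding distr_fst by (rule P.emeasure_space_1)
    moreover have "fst -` space P \<inter> space (P \<Otimes>\<^sub>M Q) = space (P \<Otimes>\<^sub>M Q)"
      by (auto simp: space_pair_measure)
    ultimately show "prob_space ?\<Omega>"
      by (intro prob_spaceI) (simp add: emeasure_distr)
    show "AE z in ?\<Omega>. a (fst z) = b (snd z)"
      by (subst AE_density) (auto simp: g_def split_beta)
  qed (simp_all add: distr_fst distr_snd)
qed

text \<open>Preimages under a continuous map turn a directed family of relatively open sets into
  another one. The swap and the diagonal map are of this kind, so their image measures need no
  separable carrier.\<close>

lemma tau_prob_distr: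
  assumes \<pi>: "\<pi> \<in> tau_prob X" and f: "continuous_on X f" "f ` X \<subseteq> Y"
  shows "distr \<pi> (restrict_space borel Y) f \<in> tau_prob Y"
proof -
  note D = tau_probD[OF \<pi>]
  interpret prob_space \<pi> by (rule D)
  have "f \<in> restrict_space borel X \<rightarrow>\<^sub>M restrict_space borel Y"
    using f by (intro measurable_restrict_space2 borel_measurable_continuous_on_restrict)
      (auto simp: space_restrict_space)
  then have meas: "f \<in> \<pi> \<rightarrow>\<^sub>M restrict_space borel Y" using D(1) by (simp cong: measurable_cong_sets)
  let ?\<nu> = "distr \<pi> (restrict_space borel Y) f"
  have "tau_additive ?\<nu>"
    unfolding tau_additive_def
  proof (intro allI impI, elim conjE)
    fix \<U> assume ne: "\<U> \<noteq> {}" and op: "\<forall>U\<in>\<U>. openin (top_of_set (space ?\<nu>)) U"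
      and dir: "\<forall>U\<in>\<U>. \<forall>V\<in>\<U>. \<exists>W\<in>\<U>. U \<union> V \<subseteq> W"
    have op: "openin (top_of_set Y) U" if "U \<in> \<U>" for U
      using op that by (simp add: space_restrict_space)
    let ?pre = "\<lambda>U. f -` U \<inter> space \<pi>"
    have "emeasure ?\<nu> (\<Union>\<U>) = emeasure \<pi> (\<Union> (?pre ` \<U>))"
      using op openin_Union[of \<U> "top_of_set Y"]
      by (subst emeasure_distr[OF meas]) (auto intro!: openin_in_sets_restrict_borel arg_cong[of _ _ "emeasure \<pi>"])
    also have "\<dots> = (SUP V\<in>?pre ` \<U>. emeasure \<pi> V)"
    proof (rule D(3)[unfolded tau_additive_def, rule_format], intro conjI ballI)
      show "?pre ` \<U> \<noteq> {}" using ne by auto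
      show "openin (top_of_set (space \<pi>)) V" if "V \<in> ?pre ` \<U>" for V
        using that op f(2) continuous_openin_preimage[OF f(1), of Y]
        by (auto simp: D(4) Int_commute image_subset_iff_funcset)
      fix V W assume "V \<in> ?pre ` \<U>" "W \<in> ?pre ` \<U>"
      then obtain V' W' where VW: "V' \<in> \<U>" "W' \<in> \<U>" "V = ?pre V'" "W = ?pre W'" by auto
      then obtain T where "T \<in> \<U>" "V' \<union> W' \<subseteq> T" using dir by blast
      with VW show "\<exists>T\<in>?pre ` \<U>. V \<union> W \<subseteq> T" by (intro bexI[of _ "?pre T"]) auto
    qed
    also have "\<dots> = (SUP U\<in>\<U>. emeasure ?\<nu> U)"
      unfolding image_comp comp_def using op
      by (intro SUP_cong refl) (simp add: emeasure_distr[OF meas] openin_in_sets_restrict_borel)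
    finally show "emeasure ?\<nu> (\<Union>\<U>) = (SUP U\<in>\<U>. emeasure ?\<nu> U)" .
  qed
  then show ?thesis using prob_space_distr[OF meas] by (simp add: tau_prob_def)
qed

lemma couplingsD:
  fixes C :: "'a::metric_space set"
  assumes "\<pi> \<in> couplings C \<mu> \<nu>"
  shows "\<pi> \<in> tau_prob (C \<times> C)" "prob_space \<pi>" "sets \<pi> = sets (restrict_space borel (C \<times> C))"
    "space \<pi> = C \<times> C"
    "fst \<in> \<pi> \<rightarrow>\<^sub>M restrict_space borel C" "snd \<in> \<pi> \<rightarrow>\<^sub>M restrict_space borel C"
    "distr \<pi> (restrict_space borel C) fst = \<mu>" "distr \<pi> (restrict_space borel C) snd = \<nu>"
proof -
  show *: "\<pi> \<in> tau_prob (C \<times> C)" "distr \<pi> (restrict_space borel C) fst = \<mu>"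
    "distr \<pi> (restrict_space borel C) snd = \<nu>" using assms by (auto simp: couplings_def)
  show "prob_space \<pi>" "space \<pi> = C \<times> C" using tau_probD[OF *(1)] by auto
  show s: "sets \<pi> = sets (restrict_space borel (C \<times> C))" using tau_probD[OF *(1)] by auto
  show "fst \<in> \<pi> \<rightarrow>\<^sub>M restrict_space borel C" "snd \<in> \<pi> \<rightarrow>\<^sub>M restrict_space borel C"
    unfolding measurable_cong_sets[OF s refl]
    by (rule measurable_restrict_borel_fst measurable_restrict_borel_snd)+
qed

section \<open>The Thompson metric\<close>

lemma thompson_dist_commute: "thompson_dist C x y = thompson_dist C y x"
  by (simp add: thompson_dist_def max.commute)

context
  fixes C :: "'a::real_normed_vector set"
  assumes cone: "open_proper_cone C"
begin

lemma cone_basic: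
  shows "C \<noteq> {}" "open C" "convex C" "\<And>x t. x \<in> C \<Longrightarrow> t > 0 \<Longrightarrow> t *\<^sub>R x \<in> C"
    "0 \<in> closure C"
    "\<And>x. x \<in> closure C \<Longrightarrow> - x \<in> closure C \<Longrightarrow> x = 0"
proof -
  show "x = 0" if "x \<in> closure C" "- x \<in> closure C" for x
  proof -
    have "x \<in> uminus ` closure C" using that(2) by (metis image_eqI minus_minus)
    then show ?thesis using that(1) cone unfolding open_proper_cone_def by blast
  qed
qed (use cone in \<open>auto simp: open_proper_cone_def\<close>)

lemma closure_cone_scaleR:
  assumes "x \<in> closure C" "t \<ge> 0"
  shows "t *\<^sub>R x \<in> closure C"
proof (cases "t = 0")
  case False
  then have "(*\<^sub>R) t ` C \<subseteq> C" using assms(2) cone_basic(4) by auto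
  then have "(*\<^sub>R) t ` closure C \<subseteq> closure C"
    by (metis closure_mono closure_scaleR)
  then show ?thesis using assms(1) by auto
qed (simp add: cone_basic)

lemma closure_cone_add:
  assumes "x \<in> closure C" "y \<in> closure C"
  shows "x + y \<in> closure C"
proof -
  have "(1/2) *\<^sub>R x + (1/2) *\<^sub>R y \<in> closure C"
    using assms convex_closure[OF cone_basic(3)] by (simp add: convex_def)
  from closure_cone_scaleR[OF this, of 2] show ?thesis by (simp add: scaleR_add_right)
qed

lemma cone_le_trans:
  "cone_le (closure C) x y \<Longrightarrow> cone_le (closure C) y z \<Longrightarrow> cone_le (closure C) x z"
  unfolding cone_le_def using closure_cone_add[of "y - x" "z - y"] by simp

lemma cone_le_scaleR:
  assumes "cone_le (closure C) x y" "t \<ge> 0"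
  shows "cone_le (closure C) (t *\<^sub>R x) (t *\<^sub>R y)"
  using closure_cone_scaleR[OF assms(1)[unfolded cone_le_def] assms(2)]
  by (simp add: cone_le_def scaleR_diff_right)

lemma cone_le_scaleR_left:
  assumes "x \<in> closure C" "s \<le> t"
  shows "cone_le (closure C) (s *\<^sub>R x) (t *\<^sub>R x)"
  using closure_cone_scaleR[OF assms(1), of "t - s"] assms(2)
  by (simp add: cone_le_def scaleR_diff_left)

text \<open>A ball about 0 inside \<open>C\<close> is scaled up to the whole space, and then
  properness of the closure leaves only 0. This separates the degenerate case, in which the infimum
  \<open>thompson_M\<close> is 0, from all others.\<close>

lemma zero_in_cone_trivial:
  assumes "0 \<in> C"
  shows "(x::'a) = 0"
proof (rule ccontr)
  assume "x \<noteq> 0"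
  have *: "y \<in> C" for y
  proof (cases "y = 0")
    case False
    obtain e where e: "e > 0" "ball 0 e \<subseteq> C" using assms cone_basic(2) by (meson openE)
    have "(e / 2 / norm y) *\<^sub>R y \<in> ball 0 e" using e False by simp
    then have "(e / 2 / norm y) *\<^sub>R y \<in> C" using e by blast
    from cone_basic(4)[OF this, of "norm y / (e / 2)"] show ?thesis using e False by simp
  qed (simp add: assms)
  have "x \<in> closure C" "- x \<in> closure C" using *[of x] *[of "-x"] closure_subset by auto
  then show False using cone_basic(6) \<open>x \<noteq> 0\<close> by blast
qed

lemma eventually_diff_in_cone:
  assumes "y \<in> C"
  shows "\<forall>\<^sub>F t in at_right 0. y - t *\<^sub>R x \<in> C"
proof -
  have "((\<lambda>t. y - t *\<^sub>R x) \<longlongrightarrow> y - 0 *\<^sub>R x) (at_right 0)"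
    by (intro tendsto_intros)
  then show ?thesis using assms cone_basic(2) by (simp add: topological_tendstoD)
qed

section \<open>The Thompson distance in terms of the order\<close>

text \<open>Openness makes \<open>y\<close> an order unit, so some multiple of \<open>y\<close>
  dominates \<open>x\<close> and the infimum is over a nonempty set. Closedness of the order makes
  the infimum attained; the value 0 would put \<open>- x\<close> into the closed cone, against
  properness.\<close>

lemma thompson_M:
  assumes "x \<in> C" "y \<in> C" "0 \<notin> C"
  shows thompson_M_pos: "thompson_M C x y > 0"
    and cone_le_thompson_M: "cone_le (closure C) x (thompson_M C x y *\<^sub>R y)"
    and thompson_M_le: "\<And>t. t > 0 \<Longrightarrow> cone_le (closure C) x (t *\<^sub>R y) \<Longrightarrow> thompson_M C x y \<le> t"
proof -
  let ?T = "{t. 0 < t \<and> cone_le (closure C) x (t *\<^sub>R y)}"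
  have bdd: "bdd_below ?T" by (auto intro!: bdd_belowI[of _ 0])
  have "\<forall>\<^sub>F t::real in at_right 0. t > 0" by (simp add: eventually_at_right_less)
  then have "\<forall>\<^sub>F t in at_right 0. t > 0 \<and> y - t *\<^sub>R x \<in> C"
    using eventually_diff_in_cone[OF assms(2), of x] by eventually_elim simp
  then obtain t where t: "t > 0" "y - t *\<^sub>R x \<in> C"
    using eventually_happens'[OF trivial_limit_at_right_real] by blast
  have "inverse t *\<^sub>R (y - t *\<^sub>R x) \<in> C" using t cone_basic(4) by simp
  then have "inverse t *\<^sub>R y - x \<in> C" using t by (simp add: scaleR_diff_right)
  then have "inverse t \<in> ?T" using t closure_subset by (auto simp: cone_le_def)
  then have ne: "?T \<noteq> {}" by blast
  have "closed {t. t *\<^sub>R y - x \<in> closure C}"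
    by (intro closed_vimage[unfolded vimage_def] continuous_intros) auto
  then have "closure ?T \<subseteq> {t. t *\<^sub>R y - x \<in> closure C}"
    by (intro closure_minimal) (auto simp: cone_le_def)
  moreover have "thompson_M C x y \<in> closure ?T"
    unfolding thompson_M_def using ne bdd by (rule closure_contains_Inf)
  ultimately show le: "cone_le (closure C) x (thompson_M C x y *\<^sub>R y)"
    by (auto simp: cone_le_def)
  have "thompson_M C x y \<ge> 0"
    unfolding thompson_M_def using ne by (rule cInf_greatest) auto
  moreover have "thompson_M C x y \<noteq> 0"
  proof
    assume "thompson_M C x y = 0"
    with le have "- x \<in> closure C" by (simp add: cone_le_def)
    then have "x = 0" using cone_basic(6)[of x] assms(1) closure_subset by blast
    then show False using assms by simp
  qed
  ultimately show "thompson_M C x y > 0" by simp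
  show "thompson_M C x y \<le> t" if "t > 0" "cone_le (closure C) x (t *\<^sub>R y)" for t
    unfolding thompson_M_def using that bdd by (intro cInf_lower) auto
qed

text \<open>In the trivial space the cone is \<open>{0}\<close>, and \<open>ln 0 = 0\<close> makes the distance vanish.\<close>
lemma thompson_dist_trivial:
  assumes "0 \<in> C"
  shows "thompson_dist C x y = 0"
proof -
  have "t *\<^sub>R v - u \<in> closure C" for t u v
    using zero_in_cone_trivial[OF assms, of "t *\<^sub>R v - u"] cone_basic(5) by simp
  then have "{t::real. 0 < t \<and> cone_le (closure C) u (t *\<^sub>R v)} = {0<..}" for u v
    by (auto simp: cone_le_def)
  then have "thompson_M C u v = 0" for u v unfolding thompson_M_def by simp
  then show ?thesis by (simp add: thompson_dist_def)
qed

lemma cone_le_exp_thompson_dist: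
  assumes "x \<in> C" "y \<in> C"
  shows "cone_le (closure C) x (exp (thompson_dist C x y) *\<^sub>R y)"
proof (cases "0 \<in> C")
  case True
  then show ?thesis using zero_in_cone_trivial cone_basic(5)
    by (metis cone_le_def)
next
  case False
  note M = thompson_M[OF assms False]
  have "thompson_M C x y = exp (ln (thompson_M C x y))" using M(1) by simp
  also have "\<dots> \<le> exp (thompson_dist C x y)" by (simp add: thompson_dist_def)
  finally show ?thesis
    using M(2) cone_le_scaleR_left cone_le_trans assms closure_subset by blast
qed

text \<open>Using the domination in both directions bounds \<open>x\<close> by exp (2d) times
  \<open>x\<close>. For negative d this puts a positive multiple of \<open>- x\<close> into the
  closed cone.\<close>

lemma thompson_dist_nonneg:
  assumes "x \<in> C" "y \<in> C"
  shows "thompson_dist C x y \<ge> 0"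
proof (rule ccontr)
  let ?d = "thompson_dist C x y"
  assume neg: "\<not> ?d \<ge> 0"
  then have "0 \<notin> C" using thompson_dist_trivial by force
  have "cone_le (closure C) (exp ?d *\<^sub>R y) (exp ?d *\<^sub>R exp ?d *\<^sub>R x)"
    using cone_le_exp_thompson_dist[OF assms(2,1)]
    by (intro cone_le_scaleR) (simp_all add: thompson_dist_commute)
  then have "cone_le (closure C) x (exp (?d + ?d) *\<^sub>R x)"
    using cone_le_exp_thompson_dist[OF assms] cone_le_trans by (metis exp_add scaleR_scaleR)
  moreover define c where "c = 1 - exp (?d + ?d)"
  ultimately have "c > 0" "(- c) *\<^sub>R x \<in> closure C"
    using neg by (simp_all add: cone_le_def scaleR_diff_left)
  then have "- x \<in> closure C"
    using closure_cone_scaleR[of "(- c) *\<^sub>R x" "1 / c"] by simp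
  then have "x = 0" using cone_basic(6)[of x] assms(1) closure_subset by blast
  then show False using assms \<open>0 \<notin> C\<close> by simp
qed

text \<open>The working form of the metric: it removes logarithm and infimum, so that the triangle
  inequality, measurability and the comparison with the norm reduce to memberships in the closed
  cone.\<close>

lemma thompson_dist_le_iff:
  assumes "x \<in> C" "y \<in> C" "r \<ge> 0"
  shows "thompson_dist C x y \<le> r \<longleftrightarrow>
    cone_le (closure C) x (exp r *\<^sub>R y) \<and> cone_le (closure C) y (exp r *\<^sub>R x)"
proof
  assume r: "thompson_dist C x y \<le> r"
  have "cone_le (closure C) u (exp r *\<^sub>R v)" if "u \<in> C" "v \<in> C" "thompson_dist C u v \<le> r" for u v
    using cone_le_exp_thompson_dist[OF that(1,2)] cone_le_scaleR_left[of v "exp (thompson_dist C u v)" "exp r"]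
      that closure_subset cone_le_trans by (metis exp_le_cancel_iff subsetD)
  then show "cone_le (closure C) x (exp r *\<^sub>R y) \<and> cone_le (closure C) y (exp r *\<^sub>R x)"
    using assms r thompson_dist_commute[of C x y] by simp
next
  assume le: "cone_le (closure C) x (exp r *\<^sub>R y) \<and> cone_le (closure C) y (exp r *\<^sub>R x)"
  show "thompson_dist C x y \<le> r"
  proof (cases "0 \<in> C")
    case False
    then have "thompson_M C x y \<le> exp r" "thompson_M C y x \<le> exp r"
      using thompson_M_le le assms by auto
    then have "ln (thompson_M C x y) \<le> r" "ln (thompson_M C y x) \<le> r"
      using thompson_M_pos[OF assms(1,2) False] thompson_M_pos[OF assms(2,1) False]
      by (metis ln_exp ln_le_cancel_iff exp_gt_zero)+
    then show ?thesis by (simp add: thompson_dist_def)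
  qed (simp add: thompson_dist_trivial assms)
qed

lemma thompson_dist_self:
  assumes "x \<in> C"
  shows "thompson_dist C x x = 0"
proof -
  have "thompson_dist C x x \<le> 0"
    using cone_basic(5) by (subst thompson_dist_le_iff[OF assms assms]) (auto simp: cone_le_def)
  then show ?thesis using thompson_dist_nonneg[OF assms assms] by simp
qed

lemma thompson_dist_triangle:
  assumes "x \<in> C" "y \<in> C" "z \<in> C"
  shows "thompson_dist C x z \<le> thompson_dist C x y + thompson_dist C y z"
proof -
  have *: "cone_le (closure C) u (exp (thompson_dist C u v + thompson_dist C v w) *\<^sub>R w)"
    if "u \<in> C" "v \<in> C" "w \<in> C" for u v w
  proof -
    have "cone_le (closure C) (exp (thompson_dist C u v) *\<^sub>R v)
        (exp (thompson_dist C u v) *\<^sub>R exp (thompson_dist C v w) *\<^sub>R w)"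
      using cone_le_exp_thompson_dist[OF that(2,3)] by (intro cone_le_scaleR) simp_all
    then show ?thesis
      using cone_le_exp_thompson_dist[OF that(1,2)] cone_le_trans
      by (metis exp_add scaleR_scaleR)
  qed
  show ?thesis
    using *[OF assms] *[OF assms(3,2,1)] assms thompson_dist_nonneg
    by (subst thompson_dist_le_iff)
       (simp_all add: thompson_dist_commute[of C y x] thompson_dist_commute[of C z y] add.commute)
qed

section \<open>Thompson balls, the norm topology and measurability\<close>

text \<open>For s > 1 the vector s x - x lies in the open cone, hence so do s y - x and s x - y for
  all y close to x in norm. The choice s = exp (r/2) turns the resulting weak bound into a strict
  one.\<close>

lemma eventually_thompson_dist_less:
  assumes "x \<in> C" "r > 0"
  shows "\<forall>\<^sub>F y in nhds x. y \<in> C \<and> thompson_dist C x y < r"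
proof -
  define s where "s = exp (r / 2)"
  have s: "s > 1" using assms by (simp add: s_def)
  then have "(s - 1) *\<^sub>R x \<in> C" using cone_basic(4)[OF assms(1), of "s - 1"] by simp
  then have in_C: "s *\<^sub>R x - x \<in> C" by (simp add: scaleR_diff_left)
  have "((\<lambda>y. s *\<^sub>R y - x) \<longlongrightarrow> s *\<^sub>R x - x) (nhds x)" "((\<lambda>y. s *\<^sub>R x - y) \<longlongrightarrow> s *\<^sub>R x - x) (nhds x)"
    by (auto intro!: tendsto_intros simp: filterlim_ident)
  then have "\<forall>\<^sub>F y in nhds x. s *\<^sub>R y - x \<in> C" "\<forall>\<^sub>F y in nhds x. s *\<^sub>R x - y \<in> C"
    using in_C cone_basic(2) by (auto simp: topological_tendstoD)
  moreover have "\<forall>\<^sub>F y in nhds x. y \<in> C"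
    using assms cone_basic(2) by (simp add: eventually_nhds_in_open)
  ultimately show ?thesis
  proof eventually_elim
    case (elim y)
    then have "thompson_dist C x y \<le> r / 2"
      using assms closure_subset by (subst thompson_dist_le_iff) (auto simp: cone_le_def s_def)
    with elim assms show ?case by simp
  qed
qed

lemma open_thompson_neighbourhood:
  assumes "F \<subseteq> C"
  shows "open {y \<in> C. \<exists>x\<in>F. thompson_dist C x y < r}"
proof (subst open_subopen, intro ballI)
  fix y assume "y \<in> {y \<in> C. \<exists>x\<in>F. thompson_dist C x y < r}"
  then obtain x where x: "y \<in> C" "x \<in> F" "x \<in> C" "thompson_dist C x y < r" using assms by auto
  have "\<forall>\<^sub>F z in nhds y. z \<in> C \<and> thompson_dist C y z < r - thompson_dist C x y"
    using x by (intro eventually_thompson_dist_less) auto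
  then obtain T where T: "open T" "y \<in> T" "\<And>z. z \<in> T \<Longrightarrow> z \<in> C \<and> thompson_dist C y z < r - thompson_dist C x y"
    by (auto simp: eventually_nhds)
  have "T \<subseteq> {y \<in> C. \<exists>x\<in>F. thompson_dist C x y < r}"
  proof
    fix z assume "z \<in> T"
    with T(3) x thompson_dist_triangle[of x y z]
    show "z \<in> {y \<in> C. \<exists>x\<in>F. thompson_dist C x y < r}" by force
  qed
  with T show "\<exists>T. open T \<and> y \<in> T \<and> T \<subseteq> {y \<in> C. \<exists>x\<in>F. thompson_dist C x y < r}" by blast
qed

text \<open>Each sublevel set is cut out of \<open>C \<times> C\<close> by two closed conditions.
  This is measurability for the Borel sets of the product topology, the reason why couplings have to
  live there.\<close>

lemma thompson_dist_measurable:
  "(\<lambda>p. thompson_dist C (fst p) (snd p)) \<in> borel_measurable (restrict_space borel (C \<times> C))"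
proof (rule borel_measurableI_le)
  fix r
  let ?R = "restrict_space borel (C \<times> C)"
  let ?A = "{p. exp r *\<^sub>R snd p - fst p \<in> closure C} \<inter> {p. exp r *\<^sub>R fst p - snd p \<in> closure C}"
  show "{p \<in> space ?R. thompson_dist C (fst p) (snd p) \<le> r} \<in> sets ?R"
  proof (cases "r \<ge> 0")
    case True
    have "closed ?A"
      by (intro closed_Int closed_vimage[unfolded vimage_def] continuous_intros) auto
    then have "(C \<times> C) \<inter> ?A \<in> sets ?R"
      unfolding sets_restrict_space by (intro image_eqI[of _ _ ?A]) auto
    also have "(C \<times> C) \<inter> ?A = {p \<in> space ?R. thompson_dist C (fst p) (snd p) \<le> r}"
      using thompson_dist_le_iff True by (auto simp: space_restrict_space cone_le_def)
    finally show ?thesis .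
  next
    case False
    then have "{p \<in> space ?R. thompson_dist C (fst p) (snd p) \<le> r} = {}"
      using thompson_dist_nonneg by (force simp: space_restrict_space)
    then show ?thesis by (simp only: sets.empty_sets)
  qed
qed

lemma thompson_dist_left_measurable:
  assumes "x \<in> C"
  shows "thompson_dist C x \<in> borel_measurable (restrict_space borel C)"
proof -
  have "(\<lambda>y. (x, y)) \<in> restrict_space borel C \<rightarrow>\<^sub>M restrict_space borel (C \<times> C)"
    using assms
    by (intro measurable_restrict_space3 borel_measurable_continuous_onI continuous_intros) auto
  from measurable_compose[OF this thompson_dist_measurable] show ?thesis by simp
qed

text \<open>A point x within r of y differs from exp (-r) y by a vector between 0 and (exp r - exp
  (-r)) y. Normality converts this order interval into a norm bound that vanishes with r.\<close>

lemma thompson_ball_in_open: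
  assumes normal: "normal_cone (closure C)" and y: "y \<in> C" and G: "open G" "y \<in> G"
  obtains r where "r > 0" "\<And>x. x \<in> C \<Longrightarrow> thompson_dist C x y < r \<Longrightarrow> x \<in> G"
proof -
  obtain K where K: "\<And>u v. cone_le (closure C) 0 u \<Longrightarrow> cone_le (closure C) u v \<Longrightarrow> norm u \<le> K * norm v"
    using normal unfolding normal_cone_def by blast
  obtain e where e: "e > 0" "ball y e \<subseteq> G" using G by (meson openE)
  \<comment> \<open>This function of r will bound the norm of \<open>x - y\<close>: the first
    summand is the normality bound, the second the cost of replacing exp (-r) y by y. It is 0 at r =
    0, so a suitable r > 0 exists.\<close>
  have "isCont (\<lambda>r. K * (norm (exp r - exp (-r)) * norm y) + norm (exp (-r) - 1) * norm y) (0::real)"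
    by (intro continuous_intros)
  then have "((\<lambda>r. K * (norm (exp r - exp (-r)) * norm y) + norm (exp (-r) - 1) * norm y)
      \<longlongrightarrow> K * (norm (exp 0 - exp (-0)) * norm y) + norm (exp (-0) - (1::real)) * norm y) (at_right (0::real))"
    unfolding isCont_def by (rule filterlim_mono) (auto intro: at_le)
  then have "\<forall>\<^sub>F r in at_right (0::real). K * (norm (exp r - exp (-r)) * norm y) + norm (exp (-r) - 1) * norm y < e"
    using e by (intro order_tendstoD) auto
  then have "\<forall>\<^sub>F r in at_right (0::real). r > 0 \<and> K * (norm (exp r - exp (-r)) * norm y) + norm (exp (-r) - 1) * norm y < e"
    using eventually_at_right_less[of 0] by eventually_elim simp
  then obtain r :: real where r: "r > 0" "K * (norm (exp r - exp (-r)) * norm y) + norm (exp (-r) - 1) * norm y < e"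
    using eventually_happens'[OF trivial_limit_at_right_real] by blast
  show thesis
  proof
    fix x assume x: "x \<in> C" "thompson_dist C x y < r"
    then have le: "cone_le (closure C) x (exp r *\<^sub>R y)" "cone_le (closure C) y (exp r *\<^sub>R x)"
      using thompson_dist_le_iff[of x y r] y r by auto
    let ?z = "x - exp (- r) *\<^sub>R y"
    have "cone_le (closure C) 0 ?z"
      using cone_le_scaleR[OF le(2), of "exp (- r)"] by (simp add: cone_le_def exp_minus)
    moreover have "cone_le (closure C) ?z ((exp r - exp (- r)) *\<^sub>R y)"
      using le(1) by (simp add: cone_le_def scaleR_diff_left)
    ultimately have z: "norm ?z \<le> K * (norm (exp r - exp (- r)) * norm y)"
      using K by (metis norm_scaleR real_norm_def)
    have "x - y = ?z + (exp (- r) - 1) *\<^sub>R y" by (simp add: scaleR_diff_left)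
    then have "norm (x - y) \<le> norm ?z + norm (exp (- r) - 1) * norm y"
      by (metis norm_scaleR norm_triangle_ineq real_norm_def)
    then have "dist y x < e" using z r by (simp add: dist_norm norm_minus_commute)
    then show "x \<in> G" using e by auto
  qed (rule r)
qed

end

section \<open>The Wasserstein metric\<close>

definition transport_cost :: "'a::real_normed_vector set \<Rightarrow> ('a \<times> 'a) measure \<Rightarrow> ennreal" where
  "transport_cost C \<pi> = (\<integral>\<^sup>+ p. ennreal (thompson_dist C (fst p) (snd p)) \<partial>\<pi>)"

lemma wasserstein_dist_eq:
  "wasserstein_dist C \<mu> \<nu> = enn2real (INF \<pi>\<in>couplings C \<mu> \<nu>. transport_cost C \<pi>)"
  by (simp add: wasserstein_dist_def transport_cost_def)

lemma wasserstein_dist_le: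
  assumes "\<pi> \<in> couplings C \<mu> \<nu>" "transport_cost C \<pi> \<le> ennreal r" "r \<ge> 0"
  shows "wasserstein_dist C \<mu> \<nu> \<le> r"
proof -
  have "(INF \<pi>\<in>couplings C \<mu> \<nu>. transport_cost C \<pi>) \<le> ennreal r"
    using assms(1,2) by (rule INF_lower2)
  then show ?thesis using assms(3) unfolding wasserstein_dist_eq by (intro enn2real_leI)
qed

lemma tau_prob1_imp_tau_prob: "\<mu> \<in> tau_prob1 C \<Longrightarrow> \<mu> \<in> tau_prob C"
  by (simp add: tau_prob1_def)

context
  fixes C :: "'a::real_normed_vector set"
  assumes cone: "open_proper_cone C"
begin

lemma coupling_thompson_measurable:
  assumes "\<pi> \<in> couplings C \<mu> \<nu>"
  shows "(\<lambda>p. thompson_dist C (fst p) (snd p)) \<in> borel_measurable \<pi>"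
  using thompson_dist_measurable[OF cone] couplingsD(3)[OF assms] by (simp cong: measurable_cong_sets)

lemma nn_integral_coupling:
  assumes \<pi>: "\<pi> \<in> couplings C \<mu> \<nu>" and h: "h \<in> borel_measurable (restrict_space borel C)"
  shows "(\<integral>\<^sup>+ p. h (fst p) \<partial>\<pi>) = (\<integral>\<^sup>+ x. h x \<partial>\<mu>)" "(\<integral>\<^sup>+ p. h (snd p) \<partial>\<pi>) = (\<integral>\<^sup>+ x. h x \<partial>\<nu>)"
proof -
  let ?R = "restrict_space borel C"
  have "(\<integral>\<^sup>+ x. h x \<partial>distr \<pi> ?R fst) = (\<integral>\<^sup>+ p. h (fst p) \<partial>\<pi>)"
    "(\<integral>\<^sup>+ x. h x \<partial>distr \<pi> ?R snd) = (\<integral>\<^sup>+ p. h (snd p) \<partial>\<pi>)"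
    using h by (simp_all add: nn_integral_distr couplingsD(5,6)[OF \<pi>])
  then show "(\<integral>\<^sup>+ p. h (fst p) \<partial>\<pi>) = (\<integral>\<^sup>+ x. h x \<partial>\<mu>)" "(\<integral>\<^sup>+ p. h (snd p) \<partial>\<pi>) = (\<integral>\<^sup>+ x. h x \<partial>\<nu>)"
    by (simp_all add: couplingsD(7,8)[OF \<pi>])
qed

lemma swap_coupling:
  assumes \<pi>: "\<pi> \<in> couplings C \<mu> \<nu>"
  shows "distr \<pi> (restrict_space borel (C \<times> C)) prod.swap \<in> couplings C \<nu> \<mu>" (is "?\<pi> \<in> _")
    and "transport_cost C (distr \<pi> (restrict_space borel (C \<times> C)) prod.swap) = transport_cost C \<pi>"
proof -
  note D = couplingsD[OF \<pi>]
  have cont: "continuous_on (C \<times> C) prod.swap"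
    unfolding prod.swap_def by (intro continuous_intros)
  have "prod.swap \<in> restrict_space borel (C \<times> C) \<rightarrow>\<^sub>M restrict_space borel (C \<times> C)"
    using cont by (intro measurable_restrict_space2 borel_measurable_continuous_on_restrict)
      (auto simp: space_restrict_space)
  then have swap: "prod.swap \<in> \<pi> \<rightarrow>\<^sub>M restrict_space borel (C \<times> C)"
    using D(3) by (simp cong: measurable_cong_sets)
  have "?\<pi> \<in> tau_prob (C \<times> C)"
    using D(1) cont by (rule tau_prob_distr) auto
  moreover have "distr ?\<pi> (restrict_space borel C) fst = \<nu>"
    using D(8) by (simp add: distr_distr[OF measurable_restrict_borel_fst swap] comp_def)
  moreover have "distr ?\<pi> (restrict_space borel C) snd = \<mu>"
    using D(7) by (simp add: distr_distr[OF measurable_restrict_borel_snd swap] comp_def)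
  ultimately show "?\<pi> \<in> couplings C \<nu> \<mu>" by (simp add: couplings_def)
  show "transport_cost C ?\<pi> = transport_cost C \<pi>"
    unfolding transport_cost_def
    using thompson_dist_measurable[OF cone]
    by (subst nn_integral_distr[OF swap]) (simp_all add: thompson_dist_commute[of C "snd _"])
qed

lemma wasserstein_dist_commute: "wasserstein_dist C \<mu> \<nu> = wasserstein_dist C \<nu> \<mu>"
proof -
  have le: "(INF \<pi>\<in>couplings C \<nu> \<mu>. transport_cost C \<pi>) \<le> (INF \<pi>\<in>couplings C \<mu> \<nu>. transport_cost C \<pi>)" for \<mu> \<nu>
    using swap_coupling by (intro INF_mono) (metis order_refl)
  show ?thesis unfolding wasserstein_dist_eq using le[of \<mu> \<nu>] le[of \<nu> \<mu>] by (metis antisym)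
qed

text \<open>Gluing along a countable partition of the middle space instead of disintegrating: a partition
  into pieces of small diameter loses only an arbitrarily small amount of transport cost.\<close>
lemma approx_glued_coupling:
  assumes p12: "\<pi>12 \<in> couplings C \<mu> \<nu>" and p23: "\<pi>23 \<in> couplings C \<nu> \<rho>"
    and tau: "\<mu> \<in> tau_prob C" "\<nu> \<in> tau_prob C" "\<rho> \<in> tau_prob C" and e: "e > 0"
  obtains \<pi> where "\<pi> \<in> couplings C \<mu> \<rho>"
    "transport_cost C \<pi> \<le> transport_cost C \<pi>12 + ennreal e + transport_cost C \<pi>23"
proof -
  note D12 = couplingsD[OF p12] and D23 = couplingsD[OF p23]
  let ?R = "restrict_space borel C" and ?R2 = "restrict_space borel (C \<times> C)"
  let ?d = "thompson_dist C"
  note tri = thompson_dist_triangle[OF cone] and comm = thompson_dist_commute[of C]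
  interpret nu: prob_space \<nu> using tau(2) by (rule tau_probD)
  obtain D S where D: "countable D" "D \<subseteq> C" "S \<in> sets \<nu>" "S \<subseteq> closure D" "AE x in \<nu>. x \<in> S"
    using tau_prob_separable_carrier[OF tau(2)] .
  have "S \<noteq> {}"
  proof
    assume "S = {}"
    with D(5) have "AE x in \<nu>. False" by simp
    then show False by simp
  qed
  then have "D \<noteq> {}" using D(4) by auto
  define d where "d = from_nat_into D"
  have d: "range d = D" unfolding d_def using \<open>D \<noteq> {}\<close> D(1) by (rule range_from_nat_into)
  then have dC: "d n \<in> C" for n using D(2) by blast
  \<comment> \<open>The label is the first centre within e/2, so two points of the carrier with the
    same label are less than e apart. Outside \<open>S\<close> there may be no such centre and the
    value is arbitrary, which a null set does not notice.\<close>
  define k where "k y = (LEAST n. ?d (d n) y < e / 2)" for y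
  have k: "k \<in> ?R \<rightarrow>\<^sub>M count_space UNIV"
    unfolding k_def
  proof (rule measurable_Least)
    fix n
    show "(\<lambda>y. ?d (d n) y < e / 2) \<in> ?R \<rightarrow>\<^sub>M count_space UNIV"
      using thompson_dist_left_measurable[OF cone dC[of n]] by measurable
  qed
  have k_less: "?d (d (k y)) y < e / 2" if y: "y \<in> S" "y \<in> C" for y
  proof -
    have "\<forall>\<^sub>F z in nhds y. z \<in> C \<and> ?d y z < e / 2"
      using y e by (intro eventually_thompson_dist_less[OF cone]) auto
    then obtain T where T: "open T" "y \<in> T" "\<And>z. z \<in> T \<Longrightarrow> ?d y z < e / 2"
      unfolding eventually_nhds by blast
    then obtain z where "z \<in> D" "z \<in> T"
      using D(4) y open_Int_closure_eq_empty[OF T(1), of D] by blast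
    then have "\<exists>n. ?d (d n) y < e / 2" using T(3) d comm by (metis imageE)
    then show ?thesis unfolding k_def by (rule LeastI_ex)
  qed
  have prems: "(k \<circ> snd) \<in> \<pi>12 \<rightarrow>\<^sub>M count_space UNIV" "(k \<circ> fst) \<in> \<pi>23 \<rightarrow>\<^sub>M count_space UNIV"
    using measurable_comp[OF D12(6) k] measurable_comp[OF D23(5) k] by auto
  \<comment> \<open>Both sides are the law of \<open>k\<close> under the shared marginal
    \<open>\<nu>\<close>.\<close>
  have "distr \<pi>12 (count_space UNIV) (k \<circ> snd) = distr \<pi>23 (count_space UNIV) (k \<circ> fst)"
    unfolding distr_distr[OF k D12(6), symmetric] distr_distr[OF k D23(5), symmetric] D12(8) D23(7) ..
  from glue_along_countable[OF D12(2) D23(2) prems this]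
  obtain \<Omega> where O: "prob_space \<Omega>" "sets \<Omega> = sets (\<pi>12 \<Otimes>\<^sub>M \<pi>23)"
    "distr \<Omega> \<pi>12 fst = \<pi>12" "distr \<Omega> \<pi>23 snd = \<pi>23" "AE z in \<Omega>. (k \<circ> snd) (fst z) = (k \<circ> fst) (snd z)" .
  interpret Om: prob_space \<Omega> by (rule O)
  have m1: "fst \<in> \<Omega> \<rightarrow>\<^sub>M \<pi>12" and m2: "snd \<in> \<Omega> \<rightarrow>\<^sub>M \<pi>23"
    using O(2) by (simp_all cong: measurable_cong_sets)
  let ?X = "fst \<circ> fst" and ?Z = "snd \<circ> snd"
  have X: "?X \<in> \<Omega> \<rightarrow>\<^sub>M ?R" and Z: "?Z \<in> \<Omega> \<rightarrow>\<^sub>M ?R"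
    using measurable_comp[OF m1 D12(5)] measurable_comp[OF m2 D23(6)] by auto
  have laws: "distr \<Omega> ?R ?X = \<mu>" "distr \<Omega> ?R ?Z = \<rho>"
    unfolding distr_distr[OF D12(5) m1, symmetric] distr_distr[OF D23(6) m2, symmetric] O(3,4)
    by (rule D12(7) D23(8))+
  from coupling_of_random_variables[OF O(1) X Z, unfolded laws, OF tau(1,3)]
  obtain f where f: "f \<in> \<Omega> \<rightarrow>\<^sub>M ?R2" "AE z in \<Omega>. f z = (?X z, ?Z z)" "distr \<Omega> ?R2 f \<in> couplings C \<mu> \<rho>" .
  have AE_S: "AE z in \<Omega>. snd (fst z) \<in> S" "AE z in \<Omega>. fst (snd z) \<in> S"
  proof -
    have "AE p in \<pi>12. snd p \<in> S"
      by (rule AE_distrD[OF D12(6)]) (unfold D12(8), rule D(5))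
    then show "AE z in \<Omega>. snd (fst z) \<in> S"
      by (intro AE_distrD[OF m1]) (unfold O(3))
    have "AE p in \<pi>23. fst p \<in> S"
      by (rule AE_distrD[OF D23(5)]) (unfold D23(7), rule D(5))
    then show "AE z in \<Omega>. fst (snd z) \<in> S"
      by (intro AE_distrD[OF m2]) (unfold O(4))
  qed
  have "AE z in \<Omega>. ennreal (?d (fst (f z)) (snd (f z))) \<le>
      ennreal (?d (fst (fst z)) (snd (fst z))) + ennreal e + ennreal (?d (fst (snd z)) (snd (snd z)))"
    using AE_S O(5) f(2) AE_space
  proof eventually_elim
    case (elim z)
    obtain x y y' w where z: "z = ((x, y), (y', w))" by (metis prod.exhaust)
    have in_C: "x \<in> C" "y \<in> C" "y' \<in> C" "w \<in> C"
      using measurable_space[OF m1 elim(5)] measurable_space[OF m2 elim(5)] by (auto simp: z D12(4) D23(4))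
    have "?d y y' \<le> ?d (d (k y)) y + ?d (d (k y)) y'"
      using tri[OF in_C(2) dC in_C(3)] comm by metis
    also have "\<dots> \<le> e"
      using k_less[of y] k_less[of y'] elim in_C by (simp add: z)
    finally have "?d x w \<le> ?d x y + e + ?d y' w"
      using tri[OF in_C(1,2,4)] tri[OF in_C(2,3,4)] by simp
    then have "ennreal (?d x w) \<le> ennreal (?d x y + e + ?d y' w)" by (rule ennreal_leI)
    then show ?case
      using elim(4) e thompson_dist_nonneg[OF cone in_C(1,2)] thompson_dist_nonneg[OF cone in_C(3,4)]
      by (simp add: z)
  qed
  then have "transport_cost C (distr \<Omega> ?R2 f) \<le> (\<integral>\<^sup>+ z. (ennreal (?d (fst (fst z)) (snd (fst z))) + ennreal e)
      + ennreal (?d (fst (snd z)) (snd (snd z))) \<partial>\<Omega>)"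
    unfolding transport_cost_def using thompson_dist_measurable[OF cone]
    by (subst nn_integral_distr[OF f(1)]) (auto intro: nn_integral_mono_AE)
  also have "\<dots> = (\<integral>\<^sup>+ z. ennreal (?d (fst (fst z)) (snd (fst z))) \<partial>\<Omega>) + ennreal e
      + (\<integral>\<^sup>+ z. ennreal (?d (fst (snd z)) (snd (snd z))) \<partial>\<Omega>)"
  proof -
    have [measurable]: "(\<lambda>z. ?d (fst (fst z)) (snd (fst z))) \<in> borel_measurable \<Omega>"
      "(\<lambda>z. ?d (fst (snd z)) (snd (snd z))) \<in> borel_measurable \<Omega>"
      using measurable_compose[OF m1 coupling_thompson_measurable[OF p12]]
        measurable_compose[OF m2 coupling_thompson_measurable[OF p23]] by simp_all
    show ?thesis by (simp add: nn_integral_add Om.emeasure_space_1)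
  qed
  also have "\<dots> = transport_cost C \<pi>12 + ennreal e + transport_cost C \<pi>23"
    unfolding transport_cost_def
    using nn_integral_distr[OF m1, of "\<lambda>p. ennreal (?d (fst p) (snd p))"]
      nn_integral_distr[OF m2, of "\<lambda>p. ennreal (?d (fst p) (snd p))"]
      coupling_thompson_measurable[OF p12] coupling_thompson_measurable[OF p23] O(3,4)
    by simp
  finally show thesis using that f(3) by blast
qed

text \<open>With a one-point label the gluing is the product measure. It lives on the product
  sigma-algebra, and \<open>coupling_of_random_variables\<close> carries it to the Borel sets of
  \<open>C \<times> C\<close>.\<close>

lemma coupling_exists:
  assumes tau: "\<mu> \<in> tau_prob C" "\<nu> \<in> tau_prob C"
  shows "couplings C \<mu> \<nu> \<noteq> {}"
proof -
  note D1 = tau_probD[OF tau(1)] and D2 = tau_probD[OF tau(2)]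
  interpret mu: prob_space \<mu> by (rule D1)
  interpret nu: prob_space \<nu> by (rule D2)
  let ?R = "restrict_space borel C"
  obtain \<Omega> where O: "prob_space \<Omega>" "sets \<Omega> = sets (\<mu> \<Otimes>\<^sub>M \<nu>)"
    "distr \<Omega> \<mu> fst = \<mu>" "distr \<Omega> \<nu> snd = \<nu>"
  proof (rule glue_along_countable[OF D1(2) D2(2), of "\<lambda>_. ()" "\<lambda>_. ()"])
    show "distr \<mu> (count_space UNIV) (\<lambda>_. ()) = distr \<nu> (count_space UNIV) (\<lambda>_. ())"
      by (simp add: mu.distr_const nu.distr_const)
  qed auto
  have X: "fst \<in> \<Omega> \<rightarrow>\<^sub>M ?R" and Y: "snd \<in> \<Omega> \<rightarrow>\<^sub>M ?R"
    using O(2) D1(1) D2(1) measurable_fst[of \<mu> \<nu>] measurable_snd[of \<mu> \<nu>]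
    by (simp_all cong: measurable_cong_sets)
  have laws: "distr \<Omega> ?R fst = \<mu>" "distr \<Omega> ?R snd = \<nu>"
    using O(3,4) D1(1) D2(1) by (metis distr_cong)+
  show ?thesis
    using coupling_of_random_variables[OF O(1) X Y, unfolded laws, OF tau] by blast
qed

text \<open>The triangle inequality through the two base points bounds the cost of any coupling by
  the two first moments plus the distance of the base points.\<close>

lemma transport_cost_finite:
  assumes mu: "\<mu> \<in> tau_prob1 C" and nu: "\<nu> \<in> tau_prob1 C" and \<pi>: "\<pi> \<in> couplings C \<mu> \<nu>"
  shows "transport_cost C \<pi> < \<infinity>"
proof -
  let ?d = "thompson_dist C"
  note tri = thompson_dist_triangle[OF cone] and nonneg = thompson_dist_nonneg[OF cone]
  obtain x0 where x0: "x0 \<in> C" "(\<integral>\<^sup>+ y. ennreal (?d x0 y) \<partial>\<mu>) < \<infinity>" using mu by (auto simp: tau_prob1_def)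
  obtain y0 where y0: "y0 \<in> C" "(\<integral>\<^sup>+ y. ennreal (?d y0 y) \<partial>\<nu>) < \<infinity>" using nu by (auto simp: tau_prob1_def)
  interpret prob_space \<pi> using \<pi> by (rule couplingsD)
  note dx = thompson_dist_left_measurable[OF cone x0(1)]
  note dy = thompson_dist_left_measurable[OF cone y0(1)]
  have [measurable]: "(\<lambda>p. ?d x0 (fst p)) \<in> borel_measurable \<pi>" "(\<lambda>p. ?d y0 (snd p)) \<in> borel_measurable \<pi>"
    using measurable_compose[OF couplingsD(5)[OF \<pi>] dx] measurable_compose[OF couplingsD(6)[OF \<pi>] dy]
    by simp_all
  have "transport_cost C \<pi> \<le> (\<integral>\<^sup>+ p. (ennreal (?d x0 (fst p)) + ennreal (?d x0 y0)) + ennreal (?d y0 (snd p)) \<partial>\<pi>)"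
    unfolding transport_cost_def
  proof (rule nn_integral_mono)
    fix p assume "p \<in> space \<pi>"
    then have p: "fst p \<in> C" "snd p \<in> C" by (auto simp: couplingsD(4)[OF \<pi>])
    have "?d (fst p) (snd p) \<le> ?d x0 (fst p) + ?d x0 y0 + ?d y0 (snd p)"
      using tri[OF p(1) x0(1) p(2)] tri[OF x0(1) y0(1) p(2)] by (simp add: thompson_dist_commute[of C "fst p" x0])
    then show "ennreal (?d (fst p) (snd p)) \<le> (ennreal (?d x0 (fst p)) + ennreal (?d x0 y0)) + ennreal (?d y0 (snd p))"
      using nonneg[OF x0(1) p(1)] nonneg[OF x0(1) y0(1)] nonneg[OF y0(1) p(2)]
      by (simp flip: ennreal_plus add: ennreal_leI)
  qed
  also have "\<dots> = (\<integral>\<^sup>+ y. ennreal (?d x0 y) \<partial>\<mu>) + ennreal (?d x0 y0) + (\<integral>\<^sup>+ y. ennreal (?d y0 y) \<partial>\<nu>)"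
    using nn_integral_coupling(1)[OF \<pi>, of "\<lambda>y. ennreal (?d x0 y)"]
      nn_integral_coupling(2)[OF \<pi>, of "\<lambda>y. ennreal (?d y0 y)"] dx dy
    by (simp add: nn_integral_add emeasure_space_1)
  also have "\<dots> < \<infinity>" using x0(2) y0(2) by simp
  finally show ?thesis .
qed

text \<open>\<open>enn2real\<close> sends infinity to 0, so a small \<open>wasserstein_dist\<close>
  says something about couplings only once the infimum is known to be finite. That needs a coupling
  to exist and its cost to be finite.\<close>

lemma wasserstein_dist_less:
  assumes "\<mu> \<in> tau_prob1 C" "\<nu> \<in> tau_prob1 C" "wasserstein_dist C \<mu> \<nu> < r"
  obtains \<pi> where "\<pi> \<in> couplings C \<mu> \<nu>" "transport_cost C \<pi> < ennreal r"
proof -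
  let ?I = "INF \<pi>\<in>couplings C \<mu> \<nu>. transport_cost C \<pi>"
  obtain \<pi> where "\<pi> \<in> couplings C \<mu> \<nu>"
    using coupling_exists assms tau_prob1_imp_tau_prob by blast
  then have "?I < \<infinity>"
    using transport_cost_finite[OF assms(1,2)] by (meson INF_lower le_less_trans)
  then have "?I = ennreal (wasserstein_dist C \<mu> \<nu>)" by (simp add: wasserstein_dist_eq)
  also have "\<dots> < ennreal r" using assms(3) by (intro ennreal_lessI) (auto simp: wasserstein_dist_eq dest: le_less_trans[OF enn2real_nonneg])
  finally show thesis using that by (auto simp: INF_less_iff)
qed

lemma wasserstein_dist_triangle:
  assumes "\<mu> \<in> tau_prob1 C" "\<nu> \<in> tau_prob1 C" "\<rho> \<in> tau_prob1 C"
  shows "wasserstein_dist C \<mu> \<rho> \<le> wasserstein_dist C \<mu> \<nu> + wasserstein_dist C \<nu> \<rho>"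
proof (rule field_le_epsilon)
  fix e :: real assume e: "e > 0"
  let ?W = "wasserstein_dist C"
  have nonneg: "?W \<mu> \<nu> \<ge> 0" "?W \<nu> \<rho> \<ge> 0" by (simp_all add: wasserstein_dist_eq)
  \<comment> \<open>The infima need not be attained: each near-optimal coupling costs one third of
    e, and the gluing costs the last third.\<close>
  obtain \<pi>12 where p12: "\<pi>12 \<in> couplings C \<mu> \<nu>" "transport_cost C \<pi>12 < ennreal (?W \<mu> \<nu> + e / 3)"
    using wasserstein_dist_less[OF assms(1,2), of "?W \<mu> \<nu> + e / 3"] e by auto
  obtain \<pi>23 where p23: "\<pi>23 \<in> couplings C \<nu> \<rho>" "transport_cost C \<pi>23 < ennreal (?W \<nu> \<rho> + e / 3)"
    using wasserstein_dist_less[OF assms(2,3), of "?W \<nu> \<rho> + e / 3"] e by auto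
  obtain \<pi> where \<pi>: "\<pi> \<in> couplings C \<mu> \<rho>"
    "transport_cost C \<pi> \<le> transport_cost C \<pi>12 + ennreal (e / 3) + transport_cost C \<pi>23"
    using approx_glued_coupling[OF p12(1) p23(1)] assms tau_prob1_imp_tau_prob e
    by (metis zero_less_divide_iff zero_less_numeral)
  have "transport_cost C \<pi> \<le> ennreal (?W \<mu> \<nu> + e / 3) + ennreal (e / 3) + ennreal (?W \<nu> \<rho> + e / 3)"
    using \<pi>(2) p12(2) p23(2) by (meson add_mono less_imp_le order_refl order_trans)
  also have "\<dots> = ennreal (?W \<mu> \<nu> + ?W \<nu> \<rho> + e)"
    using nonneg e by (simp flip: ennreal_plus)
  finally show "?W \<mu> \<rho> \<le> ?W \<mu> \<nu> + ?W \<nu> \<rho> + e"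
    using \<pi>(1) nonneg e by (intro wasserstein_dist_le) auto
qed

lemma wasserstein_dist_self:
  assumes "\<mu> \<in> tau_prob C"
  shows "wasserstein_dist C \<mu> \<mu> = 0"
proof -
  let ?f = "\<lambda>x. (x, x)" and ?R = "restrict_space borel C" and ?R2 = "restrict_space borel (C \<times> C)"
  let ?\<pi> = "distr \<mu> ?R2 ?f"
  note D = tau_probD[OF assms]
  have cont: "continuous_on C ?f" by (intro continuous_intros)
  then have "?f \<in> ?R \<rightarrow>\<^sub>M ?R2"
    by (intro measurable_restrict_space2 borel_measurable_continuous_on_restrict)
      (auto simp: space_restrict_space)
  then have f: "?f \<in> \<mu> \<rightarrow>\<^sub>M ?R2" using D(1) by (simp cong: measurable_cong_sets)
  have "?\<pi> \<in> tau_prob (C \<times> C)" using assms cont by (rule tau_prob_distr) auto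
  moreover have "distr ?\<pi> ?R fst = \<mu>" "distr ?\<pi> ?R snd = \<mu>"
    unfolding distr_distr[OF measurable_restrict_borel_fst f] distr_distr[OF measurable_restrict_borel_snd f]
    using D(1) by (simp_all add: comp_def distr_id2)
  ultimately have "?\<pi> \<in> couplings C \<mu> \<mu>" by (simp add: couplings_def)
  moreover have "transport_cost C ?\<pi> = 0"
  proof -
    have "transport_cost C ?\<pi> = (\<integral>\<^sup>+ x. ennreal (thompson_dist C x x) \<partial>\<mu>)"
      unfolding transport_cost_def using thompson_dist_measurable[OF cone]
      by (subst nn_integral_distr[OF f]) simp_all
    also have "\<dots> = (\<integral>\<^sup>+ x. 0 \<partial>\<mu>)"
      using thompson_dist_self[OF cone] by (intro nn_integral_cong) (simp add: D(4))
    finally show ?thesis by simp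
  qed
  ultimately have "wasserstein_dist C \<mu> \<mu> \<le> 0" by (intro wasserstein_dist_le) auto
  then show ?thesis by (simp add: wasserstein_dist_eq order_antisym)
qed

section \<open>Markov's inequality for couplings, and definiteness\<close>

text \<open>Under a coupling, x in A and y outside B force a distance of at least r. Hence the
  indicator of A at x is at most the indicator of B at y plus d(x,y)/r, and this is
  integrated.\<close>

lemma measure_le_wasserstein:
  assumes mu: "\<mu> \<in> tau_prob1 C" and nu: "\<nu> \<in> tau_prob1 C"
    and AB: "A \<in> sets \<mu>" "B \<in> sets \<nu>" and r: "r > 0"
    and near: "\<And>x y. x \<in> A \<Longrightarrow> y \<in> C \<Longrightarrow> thompson_dist C x y < r \<Longrightarrow> y \<in> B"
  shows "measure \<mu> A \<le> measure \<nu> B + wasserstein_dist C \<mu> \<nu> / r"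
proof (rule field_le_epsilon)
  fix e :: real assume e: "e > 0"
  let ?d = "thompson_dist C"
  note D1 = tau_probD[OF tau_prob1_imp_tau_prob[OF mu]] and D2 = tau_probD[OF tau_prob1_imp_tau_prob[OF nu]]
  interpret mu: prob_space \<mu> by (rule D1)
  interpret nu: prob_space \<nu> by (rule D2)
  have W: "wasserstein_dist C \<mu> \<nu> \<ge> 0" by (simp add: wasserstein_dist_eq)
  \<comment> \<open>The slack \<open>e * r\<close> makes room for a near-optimal coupling and
    becomes \<open>e\<close> after division by \<open>r\<close>.\<close>
  define w where "w = wasserstein_dist C \<mu> \<nu> + e * r"
  have w: "w > 0" unfolding w_def using W e r by (intro add_nonneg_pos) auto
  obtain \<pi> where \<pi>: "\<pi> \<in> couplings C \<mu> \<nu>" "transport_cost C \<pi> < ennreal w"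
    using wasserstein_dist_less[OF mu nu, of w] e r by (auto simp: w_def)
  interpret prob_space \<pi> using \<pi>(1) by (rule couplingsD)
  note AB' = AB[unfolded D1(1) D2(1)]
  have [measurable]: "(\<lambda>p. ?d (fst p) (snd p)) \<in> borel_measurable \<pi>"
    using \<pi>(1) by (rule coupling_thompson_measurable)
  have [measurable]: "(\<lambda>p. indicator B (snd p) :: ennreal) \<in> borel_measurable \<pi>"
    using AB'(2) by (intro measurable_compose[OF couplingsD(6)[OF \<pi>(1)]] borel_measurable_indicator)
  have "emeasure \<mu> A = (\<integral>\<^sup>+ x. indicator A x \<partial>\<mu>)" using AB by simp
  also have "\<dots> = (\<integral>\<^sup>+ p. indicator A (fst p) \<partial>\<pi>)"
    using AB' by (intro nn_integral_coupling(1)[OF \<pi>(1), symmetric] borel_measurable_indicator)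
  also have "\<dots> \<le> (\<integral>\<^sup>+ p. indicator B (snd p) + ennreal (1 / r) * ennreal (?d (fst p) (snd p)) \<partial>\<pi>)"
  proof (rule nn_integral_mono)
    fix p assume "p \<in> space \<pi>"
    then have p: "fst p \<in> C" "snd p \<in> C" by (auto simp: couplingsD(4)[OF \<pi>(1)])
    show "indicator A (fst p) \<le> (indicator B (snd p) + ennreal (1 / r) * ennreal (?d (fst p) (snd p)) :: ennreal)"
    proof (cases "fst p \<in> A \<and> snd p \<notin> B")
      case True
      then have "1 \<le> 1 / r * ?d (fst p) (snd p)" using near[of "fst p" "snd p"] p r by (force simp: field_simps not_less)
      then have "1 \<le> ennreal (1 / r * ?d (fst p) (snd p))" by (metis ennreal_1 ennreal_leI)
      then have "1 \<le> ennreal (1 / r) * ennreal (?d (fst p) (snd p))"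
        using r by (metis ennreal_mult' less_imp_le zero_less_divide_1_iff)
      then show ?thesis using True by simp
    qed (auto simp: indicator_def)
  qed
  also have "\<dots> = (\<integral>\<^sup>+ p. indicator B (snd p) \<partial>\<pi>) + ennreal (1 / r) * transport_cost C \<pi>"
    unfolding transport_cost_def by (subst nn_integral_add) (auto simp: nn_integral_cmult)
  also have "(\<integral>\<^sup>+ p. indicator B (snd p) \<partial>\<pi>) = emeasure \<nu> B"
    using AB AB' nn_integral_coupling(2)[OF \<pi>(1), of "indicator B"] by simp
  also have "emeasure \<nu> B + ennreal (1 / r) * transport_cost C \<pi> \<le> ennreal (measure \<nu> B) + ennreal (1 / r) * ennreal w"
    using \<pi>(2) by (intro add_mono mult_left_mono) (auto simp: nu.emeasure_eq_measure)
  also have "\<dots> = ennreal (measure \<nu> B + w / r)"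
    using w r by (simp flip: ennreal_mult ennreal_plus)
  finally have "measure \<mu> A \<le> measure \<nu> B + w / r"
    using w r by (simp add: mu.emeasure_eq_measure flip: ennreal_plus)
  also have "w / r = wasserstein_dist C \<mu> \<nu> / r + e" using r by (simp add: w_def add_divide_distrib)
  finally show "measure \<mu> A \<le> measure \<nu> B + wasserstein_dist C \<mu> \<nu> / r + e" by simp
qed

text \<open>At distance 0 the complement F of U in C has \<open>\<mu>\<close>-measure at most the
  \<open>\<nu>\<close>-measure of each Thompson neighbourhood of F. These neighbourhoods decrease to
  F, since each point of U has a Thompson ball inside U; taking complements reverses the
  inequality.\<close>

lemma measure_le_of_wasserstein_zero:
  assumes normal: "normal_cone (closure C)"
    and mu: "\<mu> \<in> tau_prob1 C" and nu: "\<nu> \<in> tau_prob1 C"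
    and W: "wasserstein_dist C \<mu> \<nu> = 0" and U: "open U" "U \<subseteq> C"
  shows "measure \<nu> U \<le> measure \<mu> U"
proof -
  note D1 = tau_probD[OF tau_prob1_imp_tau_prob[OF mu]] and D2 = tau_probD[OF tau_prob1_imp_tau_prob[OF nu]]
  interpret mu: prob_space \<mu> by (rule D1)
  interpret nu: prob_space \<nu> by (rule D2)
  let ?d = "thompson_dist C"
  define F where "F = C - U"
  define N where "N n = {y \<in> C. \<exists>x\<in>F. ?d x y < 1 / real (Suc n)}" for n
  have sets: "V \<in> sets \<mu>" "V \<in> sets \<nu>" if "open V" "V \<subseteq> C" for V
    using that cone_basic(2)[OF cone] D1(1) D2(1) openin_in_sets_restrict_borel[of C V]
    by (simp_all add: openin_open_eq)
  have N_sets: "N n \<in> sets \<nu>" for n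
    unfolding N_def by (intro sets open_thompson_neighbourhood[OF cone]) (auto simp: F_def)
  have F_sets: "F \<in> sets \<mu>" "F \<in> sets \<nu>"
    using sets[OF U] sets.compl_sets[of U \<mu>] sets.compl_sets[of U \<nu>] by (auto simp: F_def D1(4) D2(4))
  have le: "measure \<mu> F \<le> measure \<nu> (N n)" for n
    using measure_le_wasserstein[OF mu nu F_sets(1) N_sets[of n], of "1 / real (Suc n)"] W
    by (auto simp: N_def)
  have "(\<Inter>n. N n) = F"
  proof
    show "F \<subseteq> (\<Inter>n. N n)"
      using thompson_dist_self[OF cone] by (force simp: N_def F_def)
    show "(\<Inter>n. N n) \<subseteq> F"
    proof
      fix y assume y: "y \<in> (\<Inter>n. N n)"
      then have "y \<in> C" by (auto simp: N_def)
      moreover have "y \<notin> U"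
      proof
        assume "y \<in> U"
        then obtain r where r: "r > 0" "\<And>x. x \<in> C \<Longrightarrow> ?d x y < r \<Longrightarrow> x \<in> U"
          using thompson_ball_in_open[OF cone normal \<open>y \<in> C\<close> U(1)] by blast
        obtain n where "1 / real (Suc n) < r" using r(1) by (rule nat_approx_posE)
        moreover have "y \<in> N n" using y by blast
        ultimately obtain x where "x \<in> F" "?d x y < r" by (auto simp: N_def)
        then show False using r(2)[of x] by (auto simp: F_def)
      qed
      ultimately show "y \<in> F" by (simp add: F_def)
    qed
  qed
  moreover have "decseq N"
  proof (rule decseq_SucI)
    fix n
    have "1 / real (Suc (Suc n)) \<le> 1 / real (Suc n)" by (simp add: field_simps)
    then show "N (Suc n) \<subseteq> N n" unfolding N_def by (blast intro: less_le_trans)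
  qed
  ultimately have "(\<lambda>n. measure \<nu> (N n)) \<longlonglongrightarrow> measure \<nu> F"
    using nu.finite_Lim_measure_decseq[of N] N_sets by auto
  then have "measure \<mu> F \<le> measure \<nu> F"
    using le by (intro LIMSEQ_le_const) auto
  then show ?thesis
    using mu.prob_compl[OF sets(1)[OF U]] nu.prob_compl[OF sets(2)[OF U]] by (simp add: F_def D1(4) D2(4))
qed

lemma wasserstein_dist_zero_imp_eq:
  assumes normal: "normal_cone (closure C)"
    and mu: "\<mu> \<in> tau_prob1 C" and nu: "\<nu> \<in> tau_prob1 C" and W: "wasserstein_dist C \<mu> \<nu> = 0"
  shows "\<mu> = \<nu>"
proof (rule measure_eqI)
  note D1 = tau_probD[OF tau_prob1_imp_tau_prob[OF mu]] and D2 = tau_probD[OF tau_prob1_imp_tau_prob[OF nu]]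
  interpret mu: prob_space \<mu> by (rule D1)
  interpret nu: prob_space \<nu> by (rule D2)
  show "sets \<mu> = sets \<nu>" using D1 D2 by simp
  \<comment> \<open>Pushing forward along \<open>id\<close> views both measures on the whole space,
    where the open sets are an intersection-stable generator of \<open>borel\<close>.\<close>
  have id: "id \<in> \<mu> \<rightarrow>\<^sub>M borel" "id \<in> \<nu> \<rightarrow>\<^sub>M borel"
    using measurable_restrict_space1[of id borel borel C] D1(1) D2(1) by (simp_all cong: measurable_cong_sets)
  interpret mu': prob_space "distr \<mu> borel id" using id(1) by (rule mu.prob_space_distr)
  have opens: "measure \<mu> U = measure \<nu> U" if "open U" "U \<subseteq> C" for U
    using measure_le_of_wasserstein_zero[OF normal mu nu W that]
      measure_le_of_wasserstein_zero[OF normal nu mu _ that] W wasserstein_dist_commute[of \<mu> \<nu>] by simp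
  have eq: "distr \<mu> borel id = distr \<nu> borel id"
  proof (rule measure_eqI_generator_eq)
    show "Int_stable {U::'a set. open U}" by (auto simp: Int_stable_def)
    show "sets (distr \<mu> borel id) = sigma_sets UNIV {U. open U}" "sets (distr \<nu> borel id) = sigma_sets UNIV {U. open U}"
      by (simp_all add: borel_def)
    fix U :: "'a set" assume "U \<in> {U. open U}"
    then show "emeasure (distr \<mu> borel id) U = emeasure (distr \<nu> borel id) U"
      using id opens[of "U \<inter> C"] cone_basic(2)[OF cone]
      by (simp add: emeasure_distr D1(4) D2(4) mu.emeasure_eq_measure nu.emeasure_eq_measure open_Int)
  next
    show "range (\<lambda>_::nat. UNIV) \<subseteq> {U::'a set. open U}" "(\<Union>i::nat. UNIV) = (UNIV :: 'a set)" by auto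
    show "emeasure (distr \<mu> borel id) UNIV \<noteq> \<infinity>" by simp
  qed auto
  fix A assume "A \<in> sets \<mu>"
  then obtain T where T: "T \<in> sets borel" "A = C \<inter> T" by (auto simp: D1(1) sets_restrict_space)
  then show "emeasure \<mu> A = emeasure \<nu> A"
    using arg_cong[OF eq, of "\<lambda>m. emeasure m T"] id by (simp add: emeasure_distr D1(4) D2(4) Int_commute)
qed

lemma Metric_space_wasserstein:
  assumes "normal_cone (closure C)"
  shows "Metric_space (tau_prob1 C) (wasserstein_dist C)"
proof
  show "0 \<le> wasserstein_dist C \<mu> \<nu>" for \<mu> \<nu> by (simp add: wasserstein_dist_eq)
  show "wasserstein_dist C \<mu> \<nu> = wasserstein_dist C \<nu> \<mu>" for \<mu> \<nu> by (rule wasserstein_dist_commute)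
  show "wasserstein_dist C \<mu> \<nu> = 0 \<longleftrightarrow> \<mu> = \<nu>" if "\<mu> \<in> tau_prob1 C" "\<nu> \<in> tau_prob1 C" for \<mu> \<nu>
    using that wasserstein_dist_zero_imp_eq[OF assms] wasserstein_dist_self tau_prob1_imp_tau_prob by blast
qed (rule wasserstein_dist_triangle)

section \<open>Dilates of upper sets and persistence of a violation\<close>

text \<open>Multiplying x \<le> exp r y by exp (-s) gives exp (-s) x \<le> exp (-(s-r)) y, and
  \<open>U\<close> is an upper set.\<close>

lemma thompson_near_upper_set:
  assumes U: "upper_set_in C U" and x: "exp (- s) *\<^sub>R x \<in> U" "x \<in> C"
    and y: "y \<in> C" "thompson_dist C x y < r" and r: "r \<ge> 0"
  shows "exp (- (s - r)) *\<^sub>R y \<in> U"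
proof -
  have "cone_le (closure C) x (exp r *\<^sub>R y)"
    using thompson_dist_le_iff[OF cone x(2) y(1) r] y(2) by simp
  from cone_le_scaleR[OF cone this, of "exp (- s)"]
  have "cone_le (closure C) (exp (- s) *\<^sub>R x) (exp (- (s - r)) *\<^sub>R y)"
    by (simp add: exp_add[symmetric])
  moreover have "exp (- (s - r)) *\<^sub>R y \<in> C" using cone_basic(4)[OF cone y(1)] by simp
  ultimately show ?thesis using U x(1) unfolding upper_set_in_def by blast
qed

lemma open_scaled_preimage:
  assumes "open U"
  shows "open {x \<in> C. exp (- s) *\<^sub>R x \<in> U}"
proof -
  have "open ((\<lambda>x. exp (- s) *\<^sub>R x) -` U)"
    by (intro open_vimage assms continuous_intros)
  then show ?thesis using cone_basic(2)[OF cone] by (auto simp: Collect_conj_eq vimage_def intro: open_Int)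
qed

lemma upper_set_scaled_preimage:
  assumes U: "upper_set_in C U"
  shows "upper_set_in C {x \<in> C. exp (- s) *\<^sub>R x \<in> U}"
  unfolding upper_set_in_def
proof (intro conjI ballI impI)
  fix x y assume x: "x \<in> {x \<in> C. exp (- s) *\<^sub>R x \<in> U}" and y: "y \<in> C" "cone_le (closure C) x y"
  have "cone_le (closure C) (exp (- s) *\<^sub>R x) (exp (- s) *\<^sub>R y)"
    using y(2) by (intro cone_le_scaleR[OF cone]) auto
  then show "y \<in> {x \<in> C. exp (- s) *\<^sub>R x \<in> U}"
    using U x y(1) cone_basic(4)[OF cone y(1)] unfolding upper_set_in_def by auto
qed auto

lemma stochastic_le_separation:
  assumes mu: "\<mu> \<in> tau_prob1 C" and nu: "\<nu> \<in> tau_prob1 C" and "\<not> stochastic_le C \<mu> \<nu>"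
  obtains e where "e > 0" "\<And>\<mu>' \<nu>'. \<mu>' \<in> tau_prob1 C \<Longrightarrow> \<nu>' \<in> tau_prob1 C \<Longrightarrow>
    wasserstein_dist C \<mu> \<mu>' < e \<Longrightarrow> wasserstein_dist C \<nu> \<nu>' < e \<Longrightarrow> \<not> stochastic_le C \<mu>' \<nu>'"
proof -
  note D1 = tau_probD[OF tau_prob1_imp_tau_prob[OF mu]] and D2 = tau_probD[OF tau_prob1_imp_tau_prob[OF nu]]
  interpret mu: prob_space \<mu> by (rule D1)
  interpret nu: prob_space \<nu> by (rule D2)
  obtain U where U: "openin (top_of_set C) U" "upper_set_in C U" "emeasure \<mu> U > emeasure \<nu> U"
    using assms(3) by (auto simp: stochastic_le_def not_le)
  then have oU: "open U" "U \<subseteq> C" using cone_basic(2)[OF cone] by (auto simp: openin_open_eq)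
  define V where "V s = {x \<in> C. exp (- s) *\<^sub>R x \<in> U}" for s
  have oV: "openin (top_of_set C) (V s)" for s
    using open_scaled_preimage[OF oU(1), of s] cone_basic(2)[OF cone] by (auto simp: V_def openin_open_eq)
  have upV: "upper_set_in C (V s)" for s
    unfolding V_def using U(2) by (rule upper_set_scaled_preimage)
  have V_sets: "V s \<in> sets \<rho>" if "\<rho> \<in> tau_prob1 C" for s \<rho>
    using tau_prob_sets_openin[OF tau_prob1_imp_tau_prob[OF that] oV] .
  have V0: "V 0 = U" using oU by (auto simp: V_def)
  have V_mono: "V s \<subseteq> V t" if "t \<le> s" for s t
  proof
    fix x assume x: "x \<in> V s"
    then have "cone_le (closure C) (exp (- s) *\<^sub>R x) (exp (- t) *\<^sub>R x)"
      using that closure_subset by (intro cone_le_scaleR_left[OF cone]) (auto simp: V_def)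
    then show "x \<in> V t" using x U(2) cone_basic(4)[OF cone, of x] by (auto simp: V_def upper_set_in_def)
  qed
  \<comment> \<open>Points of \<open>U\<close> stay in the open set \<open>U\<close> under scaling
    by a factor close to 1, so shrinking the dilation exhausts \<open>U\<close> from inside.\<close>
  have V_Un: "(\<Union>n. V (1 / real (Suc n))) = U"
  proof
    show "(\<Union>n. V (1 / real (Suc n))) \<subseteq> U" using V_mono[of 0] V0 by (intro UN_least) simp
    show "U \<subseteq> (\<Union>n. V (1 / real (Suc n)))"
    proof
      fix x assume x: "x \<in> U"
      have "isCont (\<lambda>s. exp (- s) *\<^sub>R x) (0::real)" by (intro continuous_intros)
      then have "((\<lambda>s. exp (- s) *\<^sub>R x) \<longlongrightarrow> x) (at 0)" by (simp add: isCont_def)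
      then have "(\<lambda>n. exp (- (1 / real (Suc n))) *\<^sub>R x) \<longlonglongrightarrow> x"
        by (rule filterlim_compose) (use LIMSEQ_Suc[OF lim_1_over_n[where 'a=real]] in \<open>auto simp: filterlim_at\<close>)
      then have "\<forall>\<^sub>F n in sequentially. exp (- (1 / real (Suc n))) *\<^sub>R x \<in> U"
        using oU x by (simp add: topological_tendstoD)
      then obtain n where "exp (- (1 / real (Suc n))) *\<^sub>R x \<in> U" by (auto simp: eventually_sequentially)
      then show "x \<in> (\<Union>n. V (1 / real (Suc n)))" using x oU by (auto simp: V_def)
    qed
  qed
  have "(\<lambda>n. measure \<mu> (V (1 / real (Suc n)))) \<longlonglongrightarrow> measure \<mu> (\<Union>n. V (1 / real (Suc n)))"
    using V_sets[OF mu] by (intro mu.finite_Lim_measure_incseq incseq_SucI V_mono) (auto simp: field_simps)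
  moreover have "measure \<nu> U < measure \<mu> U"
    using U(3) by (simp add: mu.emeasure_eq_measure nu.emeasure_eq_measure ennreal_less_iff)
  ultimately have "\<forall>\<^sub>F n in sequentially. measure \<nu> U < measure \<mu> (V (1 / real (Suc n)))"
    unfolding V_Un by (intro order_tendstoD)
  then obtain n where n: "measure \<nu> U < measure \<mu> (V (1 / real (Suc n)))"
    by (auto simp: eventually_sequentially)
  \<comment> \<open>Half of the dilation found above: each of the two comparisons below uses up one
    \<open>r\<close>, leading from \<open>V (r + r)\<close> through \<open>V r\<close> to
    \<open>V 0 = U\<close>.\<close>
  define r where "r = 1 / real (Suc n) / 2"
  have r: "r > 0" by (simp add: r_def)
  have rr: "r + r = 1 / real (Suc n)" unfolding r_def by (rule field_sum_of_halves)
  define gap where "gap = measure \<mu> (V (r + r)) - measure \<nu> U"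
  have gap: "gap > 0" using n by (simp add: gap_def rr)
  have near: "y \<in> V (s - r)" if "x \<in> V s" "y \<in> C" "thompson_dist C x y < r" for x y s
    using thompson_near_upper_set[OF U(2), of s x y r] that r by (auto simp: V_def)
  show thesis
  proof
    \<comment> \<open>After the division by \<open>r\<close> in Markov's inequality, each of the two
      errors stays below \<open>gap / 2\<close>, so together they do not close the gap.\<close>
    show "gap * r / 2 > 0" using gap r by simp
    fix \<mu>' \<nu>' assume m: "\<mu>' \<in> tau_prob1 C" "\<nu>' \<in> tau_prob1 C"
      and W: "wasserstein_dist C \<mu> \<mu>' < gap * r / 2" "wasserstein_dist C \<nu> \<nu>' < gap * r / 2"
    interpret mu': prob_space \<mu>' using tau_probD(2)[OF tau_prob1_imp_tau_prob[OF m(1)]] .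
    interpret nu': prob_space \<nu>' using tau_probD(2)[OF tau_prob1_imp_tau_prob[OF m(2)]] .
    have "measure \<mu> (V (r + r)) \<le> measure \<mu>' (V r) + wasserstein_dist C \<mu> \<mu>' / r"
      using near[of _ "r + r"] by (intro measure_le_wasserstein mu m V_sets r) auto
    moreover have "measure \<nu>' (V r) \<le> measure \<nu> (V 0) + wasserstein_dist C \<nu>' \<nu> / r"
      using near[of _ r] by (intro measure_le_wasserstein nu m V_sets r) auto
    moreover have "wasserstein_dist C \<mu> \<mu>' / r < gap / 2" "wasserstein_dist C \<nu>' \<nu> / r < gap / 2"
      using W r by (simp_all add: field_simps wasserstein_dist_commute[of \<nu>' \<nu>])
    moreover have "n' < m'" if "m \<le> m' + a" "n' \<le> n + b" "a < (m - n) / 2" "b < (m - n) / 2"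
      for m m' n n' a b :: real
      using that by (simp add: field_simps)
    ultimately have "measure \<nu>' (V r) < measure \<mu>' (V r)" unfolding V0 gap_def by blast
    then have "\<not> emeasure \<mu>' (V r) \<le> emeasure \<nu>' (V r)"
      by (simp add: mu'.emeasure_eq_measure nu'.emeasure_eq_measure)
    then show "\<not> stochastic_le C \<mu>' \<nu>'" using oV upV unfolding stochastic_le_def by blast
  qed
qed

end

theorem corollary5p6:
  fixes C :: "'a::banach set"
  assumes "open_proper_cone C"
    and "normal_cone (closure C)"
  shows "closedin (prod_topology (wasserstein_topology C) (wasserstein_topology C))
           {(\<mu>, \<nu>). \<mu> \<in> tau_prob1 C \<and> \<nu> \<in> tau_prob1 C \<and> stochastic_le C \<mu> \<nu>}"
    (is "closedin ?T ?S")
proof -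
  interpret W: Metric_space "tau_prob1 C" "wasserstein_dist C"
    using assms by (rule Metric_space_wasserstein)
  show ?thesis
    unfolding wasserstein_topology_def closedin_def topspace_prod_topology W.topspace_mtopology
  proof
    show "?S \<subseteq> tau_prob1 C \<times> tau_prob1 C" by auto
    show "openin (prod_topology W.mtopology W.mtopology) (tau_prob1 C \<times> tau_prob1 C - ?S)"
      unfolding openin_prod_topology_alt
    proof (intro allI impI)
      fix \<mu> \<nu> assume "(\<mu>, \<nu>) \<in> tau_prob1 C \<times> tau_prob1 C - ?S"
      then have m: "\<mu> \<in> tau_prob1 C" "\<nu> \<in> tau_prob1 C" "\<not> stochastic_le C \<mu> \<nu>" by auto
      obtain e where e: "e > 0" "\<And>\<mu>' \<nu>'. \<mu>' \<in> tau_prob1 C \<Longrightarrow> \<nu>' \<in> tau_prob1 C \<Longrightarrow>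
          wasserstein_dist C \<mu> \<mu>' < e \<Longrightarrow> wasserstein_dist C \<nu> \<nu>' < e \<Longrightarrow> \<not> stochastic_le C \<mu>' \<nu>'"
        using stochastic_le_separation[OF assms(1) m] by blast
      then have "W.mball \<mu> e \<times> W.mball \<nu> e \<subseteq> tau_prob1 C \<times> tau_prob1 C - ?S" by auto
      then show "\<exists>U V. openin W.mtopology U \<and> openin W.mtopology V \<and> \<mu> \<in> U \<and> \<nu> \<in> V \<and>
          U \<times> V \<subseteq> tau_prob1 C \<times> tau_prob1 C - ?S"
        using m e(1) by (intro exI[of _ "W.mball \<mu> e"] exI[of _ "W.mball \<nu> e"]) auto
    qed
  qed
qed

end
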